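(* Let $G$ be a countable directed graph and let $x,y\in\mathcal{V}(G)$ with $x\neq y$. Assume there are exactly $n$ distinct edges with source $x$ and range $y$, $1\le n\le\infty$. Then the ideal $\operatorname{rad}(\mathfrak{L}_G/\mathcal{K}^{w^*}_{x,y})$ of $\mathfrak{L}_G/\mathcal{K}^{w^*}_{x,y}$ is sequentially $n$-generated with respect to the weak-$*$ topology of $\mathfrak{L}_G/\mathcal{K}^{w^*}_{x,y}$; the cosets $L_{e_i}+\mathcal{K}^{w^*}_{x,y}$ of the edges $e_i$ from $x$ to $y$ form such a generating set, and no weak-$*$ generating set has fewer than $n$ elements.
   Context: A countable directed graph $G$ has countable vertex set $\mathcal{V}(G)$, edge set $\mathcal{E}(G)$, range and source maps $r,s$. The free semigroupoid $\mathbb{F}^+(G)$ consists of vertices and finite paths $w=e_k\cdots e_1$ with $s(e_i)=r(e_{i-1})$, $s(w)=s(e_1)$, $r(w)=r(e_k)$. On $\mathcal{H}_G=\ell^2(\mathbb{F}^+(G))$ with orthonormal basis $\{\xi_w\}$, $L_e\xi_w=\xi_{ew}$ if $s(e)=r(w)$ and $0$ otherwise, and $P_v$ is the projection onto $\overline{\operatorname{span}}\{\xi_w:r(w)=v\}$. $\mathfrak{L}_G$ is the weak operator topology closed algebra generated by all $L_e$ and $P_v$. $\mathfrak{M}^{w^*}_{G,x}$ is the set of weak-$*$ continuous characters $\rho$ of $\mathfrak{L}_G$ with $\rho(P_x)=1$. A weak-$*$ continuous two-dimensional nest representation is a weak-$*$ continuous homomorphism $\pi$ of $\mathfrak{L}_G$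 onto the algebra $\operatorname{Alg}\mathcal{N}$ of operators on a 2-dimensional Hilbert space leaving a fixed one-dimensional subspace $N$ invariant; with unit vectors $h_2\in N$, $h_1\in N^\perp$, $\rho^{(i)}_\pi(A)=\langle\pi(A)h_i,h_i\rangle$. $\operatorname{rep}^{w^*}_{x,y}(\mathfrak{L}_G)$ is the set of such $\pi$ with $\rho^{(1)}_\pi\in\mathfrak{M}^{w^*}_{G,x}$, $\rho^{(2)}_\pi\in\mathfrak{M}^{w^*}_{G,y}$, and $\mathcal{K}^{w^*}_{x,y}=\bigcap\{\ker\pi:\pi\in\operatorname{rep}^{w^*}_{x,y}(\mathfrak{L}_G)\}$. The quotient $\mathfrak{L}_G/\mathcal{K}^{w^*}_{x,y}$ is identified with the dual of the space of weak-$*$ continuous functionals on $\mathfrak{L}_G$ vanishing on $\mathcal{K}^{w^*}_{x,y}$, which gives it a weak-$*$ topology. $\operatorname{rad}$ denotes the Jacobson radical. For a weak-$*$ closed ideal $\mathcal{I}$ of a dual Banach algebra, a subset is a weak-$*$ generating set if the weak-$*$ closed ideal it generates is $\mathcal{I}$; $\mathcal{I}$ is $n$-generated (weak-$*$) if $n$ is the least cardinality of such a set, and sequentially $n$-generated if moreover the set of weak-$*$ limits of sequences from the algebraic ideal generated by some $n$ generators equals $\mathcal{I}$. *)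

theory Defs
  imports "HOL-Analysis.Analysis" "HOL-Library.Extended_Nat"
begin

text \<open>A graph is given by types of vertices 'v and edges 'e (both countable)
and range / source maps r, s. Elements of the free semigroupoid: vertices
V v, and paths P [e_k, ..., e_1] (written left to right as e_k ... e_1).\<close>

datatype ('v,'e) fsg = V 'v | P "'e list"

definition valid :: "('e \<Rightarrow> 'v) \<Rightarrow> ('e \<Rightarrow> 'v) \<Rightarrow> ('v,'e) fsg \<Rightarrow> bool" where
  "valid r s w = (case w of V v \<Rightarrow> True
     | P es \<Rightarrow> es \<noteq> [] \<and> (\<forall>i. Suc i < length es \<longrightarrow> s (es ! i) = r (es ! Suc i)))"

definition rg :: "('e \<Rightarrow> 'v) \<Rightarrow> ('v,'e) fsg \<Rightarrow> 'v" where
  "rg r w = (case w of V v \<Rightarrow> v | P es \<Rightarrow> r (hd es))"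

type_synonym ('v,'e) vec = "('v,'e) fsg \<Rightarrow> complex"
type_synonym ('v,'e) op = "('v,'e) vec \<Rightarrow> ('v,'e) vec"

definition Hs :: "('e \<Rightarrow> 'v) \<Rightarrow> ('e \<Rightarrow> 'v) \<Rightarrow> ('v,'e) vec set" where
  "Hs r s = {\<xi>. (\<forall>w. \<not> valid r s w \<longrightarrow> \<xi> w = 0) \<and> (\<lambda>w. (cmod (\<xi> w))\<^sup>2) summable_on UNIV}"

definition inner2 :: "('v,'e) vec \<Rightarrow> ('v,'e) vec \<Rightarrow> complex" where
  "inner2 \<xi> \<eta> = infsum (\<lambda>w. \<xi> w * cnj (\<eta> w)) UNIV"

definition nrm2 :: "('v,'e) vec \<Rightarrow> real" where
  "nrm2 \<xi> = sqrt (infsum (\<lambda>w. (cmod (\<xi> w))\<^sup>2) UNIV)"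

definition vsub :: "('v,'e) vec \<Rightarrow> ('v,'e) vec \<Rightarrow> ('v,'e) vec" where
  "vsub \<xi> \<eta> = (\<lambda>w. \<xi> w - \<eta> w)"

text \<open>Bounded operators on H_G, normalised to vanish outside H_G.\<close>
definition Bnd :: "('e \<Rightarrow> 'v) \<Rightarrow> ('e \<Rightarrow> 'v) \<Rightarrow> ('v,'e) op set" where
  "Bnd r s = {T. (\<forall>\<xi>. \<xi> \<notin> Hs r s \<longrightarrow> T \<xi> = (\<lambda>w. 0))
     \<and> (\<forall>\<xi>\<in>Hs r s. T \<xi> \<in> Hs r s)
     \<and> (\<forall>\<xi>\<in>Hs r s. \<forall>\<eta>\<in>Hs r s. \<forall>c::complex.
           T (\<lambda>w. c * \<xi> w + \<eta> w) = (\<lambda>w. c * T \<xi> w + T \<eta> w))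
     \<and> (\<exists>C. \<forall>\<xi>\<in>Hs r s. nrm2 (T \<xi>) \<le> C * nrm2 \<xi>)}"

definition oadd :: "('v,'e) op \<Rightarrow> ('v,'e) op \<Rightarrow> ('v,'e) op" where
  "oadd T S = (\<lambda>\<xi> w. T \<xi> w + S \<xi> w)"

definition osub :: "('v,'e) op \<Rightarrow> ('v,'e) op \<Rightarrow> ('v,'e) op" where
  "osub T S = (\<lambda>\<xi> w. T \<xi> w - S \<xi> w)"

definition oscale :: "complex \<Rightarrow> ('v,'e) op \<Rightarrow> ('v,'e) op" where
  "oscale c T = (\<lambda>\<xi> w. c * T \<xi> w)"

definition omul :: "('v,'e) op \<Rightarrow> ('v,'e) op \<Rightarrow> ('v,'e) op" where
  "omul T S = T \<circ> S"

definition ozero :: "('v,'e) op" where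
  "ozero = (\<lambda>\<xi> w. 0)"

definition Lop :: "('e \<Rightarrow> 'v) \<Rightarrow> ('e \<Rightarrow> 'v) \<Rightarrow> 'e \<Rightarrow> ('v,'e) op" where
  "Lop r s e = (\<lambda>\<xi>. if \<xi> \<in> Hs r s then
      (\<lambda>u. if valid r s u then
             (case u of V _ \<Rightarrow> 0
               | P es \<Rightarrow> (case es of [] \<Rightarrow> 0
                  | f # rest \<Rightarrow> if f = e then (if rest = [] then \<xi> (V (s e)) else \<xi> (P rest)) else 0))
           else 0)
    else (\<lambda>w. 0))"

definition Pop :: "('e \<Rightarrow> 'v) \<Rightarrow> ('e \<Rightarrow> 'v) \<Rightarrow> 'v \<Rightarrow> ('v,'e) op" where
  "Pop r s v = (\<lambda>\<xi>. if \<xi> \<in> Hs r s then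
      (\<lambda>u. if valid r s u \<and> rg r u = v then \<xi> u else 0) else (\<lambda>w. 0))"

definition subalg :: "('v,'e) op set \<Rightarrow> bool" where
  "subalg S = (ozero \<in> S \<and> (\<forall>A\<in>S. \<forall>B\<in>S. oadd A B \<in> S \<and> omul A B \<in> S)
     \<and> (\<forall>A\<in>S. \<forall>c. oscale c A \<in> S))"

definition wot_closed :: "('e \<Rightarrow> 'v) \<Rightarrow> ('e \<Rightarrow> 'v) \<Rightarrow> ('v,'e) op set \<Rightarrow> bool" where
  "wot_closed r s S = (\<forall>T\<in>Bnd r s.
     (\<forall>F. finite F \<longrightarrow> F \<subseteq> Hs r s \<times> Hs r s \<longrightarrow> (\<forall>\<epsilon>>0. \<exists>A\<in>S.
        \<forall>(\<xi>,\<eta>)\<in>F. cmod (inner2 (vsub (T \<xi>) (A \<xi>)) \<eta>) < \<epsilon>)) \<longrightarrow> T \<in> S)"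

definition LG :: "('e \<Rightarrow> 'v) \<Rightarrow> ('e \<Rightarrow> 'v) \<Rightarrow> ('v,'e) op set" where
  "LG r s = \<Inter>{S. S \<subseteq> Bnd r s \<and> subalg S \<and> wot_closed r s S
      \<and> range (Lop r s) \<subseteq> S \<and> range (Pop r s) \<subseteq> S}"

text \<open>Weak-* (= sigma-weakly) continuous functionals on L_G: restrictions of
normal functionals A \<mapsto> sum_n <A xi_n, eta_n> with square-summable norms.\<close>
definition wstar_fun :: "('e \<Rightarrow> 'v) \<Rightarrow> ('e \<Rightarrow> 'v) \<Rightarrow> (('v,'e) op \<Rightarrow> complex) \<Rightarrow> bool" where
  "wstar_fun r s \<phi> = (\<exists>xs ys :: nat \<Rightarrow> ('v,'e) vec.
      (\<forall>n. xs n \<in> Hs r s \<and> ys n \<in> Hs r s)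
      \<and> summable (\<lambda>n. (nrm2 (xs n))\<^sup>2) \<and> summable (\<lambda>n. (nrm2 (ys n))\<^sup>2)
      \<and> (\<forall>A\<in>LG r s. (\<lambda>n. inner2 (A (xs n)) (ys n)) sums \<phi> A))"

definition Mchar :: "('e \<Rightarrow> 'v) \<Rightarrow> ('e \<Rightarrow> 'v) \<Rightarrow> 'v \<Rightarrow> (('v,'e) op \<Rightarrow> complex) \<Rightarrow> bool" where
  "Mchar r s x \<rho> = (wstar_fun r s \<rho>
     \<and> (\<forall>A\<in>LG r s. \<forall>B\<in>LG r s. \<forall>c. \<rho> (oadd A B) = \<rho> A + \<rho> B
          \<and> \<rho> (oscale c A) = c * \<rho> A \<and> \<rho> (omul A B) = \<rho> A * \<rho> B)
     \<and> \<rho> (Pop r s x) = 1)"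

text \<open>Two-dimensional nest representations. Without loss of generality the
2-dimensional space is C^2 with N = span e_2, h_2 = e_2, h_1 = e_1; then
Alg N = {M. M\$1\$2 = 0} (M\$i\$j = row i, column j).\<close>
definition nest_rep :: "('e \<Rightarrow> 'v) \<Rightarrow> ('e \<Rightarrow> 'v) \<Rightarrow> (('v,'e) op \<Rightarrow> complex^2^2) \<Rightarrow> bool" where
  "nest_rep r s \<pi> = (
     (\<forall>A\<in>LG r s. \<forall>B\<in>LG r s. \<forall>c. \<pi> (oadd A B) = \<pi> A + \<pi> B
          \<and> (\<forall>i j. \<pi> (oscale c A) $ i $ j = c * (\<pi> A $ i $ j))
          \<and> \<pi> (omul A B) = \<pi> A ** \<pi> B)
     \<and> (\<forall>i j. wstar_fun r s (\<lambda>A. \<pi> A $ i $ j))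
     \<and> \<pi> ` LG r s = {M. M $ 1 $ 2 = 0})"

definition rep_xy :: "('e \<Rightarrow> 'v) \<Rightarrow> ('e \<Rightarrow> 'v) \<Rightarrow> 'v \<Rightarrow> 'v \<Rightarrow> (('v,'e) op \<Rightarrow> complex^2^2) set" where
  "rep_xy r s x y = {\<pi>. nest_rep r s \<pi> \<and> Mchar r s x (\<lambda>A. \<pi> A $ 1 $ 1)
                                      \<and> Mchar r s y (\<lambda>A. \<pi> A $ 2 $ 2)}"

definition Kxy :: "('e \<Rightarrow> 'v) \<Rightarrow> ('e \<Rightarrow> 'v) \<Rightarrow> 'v \<Rightarrow> 'v \<Rightarrow> ('v,'e) op set" where
  "Kxy r s x y = {A\<in>LG r s. \<forall>\<pi>\<in>rep_xy r s x y. \<pi> A = 0}"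

text \<open>Subsets of the quotient are represented by their preimages in L_G.
The weak-* topology on the quotient is sigma(L_G/K, K_perp), where K_perp
is the set of weak-* continuous functionals on L_G vanishing on K.\<close>

definition Kperp :: "('e \<Rightarrow> 'v) \<Rightarrow> ('e \<Rightarrow> 'v) \<Rightarrow> ('v,'e) op set \<Rightarrow> (('v,'e) op \<Rightarrow> complex) set" where
  "Kperp r s K = {\<phi>. wstar_fun r s \<phi> \<and> (\<forall>A\<in>K. \<phi> A = 0)}"

definition q_closed :: "('e \<Rightarrow> 'v) \<Rightarrow> ('e \<Rightarrow> 'v) \<Rightarrow> ('v,'e) op set \<Rightarrow> ('v,'e) op set \<Rightarrow> bool" where
  "q_closed r s K J = (J \<subseteq> LG r s \<and> (\<forall>T\<in>LG r s.
     (\<forall>F. finite F \<longrightarrow> F \<subseteq> Kperp r s K \<longrightarrow> (\<forall>\<epsilon>>0. \<exists>A\<in>J. \<forall>\<phi>\<in>F. cmod (\<phi> T - \<phi> A) < \<epsilon>))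
       \<longrightarrow> T \<in> J))"

definition q_ideal :: "('e \<Rightarrow> 'v) \<Rightarrow> ('e \<Rightarrow> 'v) \<Rightarrow> ('v,'e) op set \<Rightarrow> ('v,'e) op set \<Rightarrow> bool" where
  "q_ideal r s K J = (K \<subseteq> J \<and> J \<subseteq> LG r s
     \<and> (\<forall>A\<in>J. \<forall>B\<in>J. oadd A B \<in> J) \<and> (\<forall>A\<in>J. \<forall>c. oscale c A \<in> J)
     \<and> (\<forall>A\<in>J. \<forall>B\<in>LG r s. omul A B \<in> J \<and> omul B A \<in> J))"

definition wgen_ideal :: "('e \<Rightarrow> 'v) \<Rightarrow> ('e \<Rightarrow> 'v) \<Rightarrow> ('v,'e) op set \<Rightarrow> ('v,'e) op set \<Rightarrow> ('v,'e) op set" where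
  "wgen_ideal r s K S = \<Inter>{J. q_ideal r s K J \<and> q_closed r s K J \<and> S \<subseteq> J}"

definition is_wgen :: "('e \<Rightarrow> 'v) \<Rightarrow> ('e \<Rightarrow> 'v) \<Rightarrow> ('v,'e) op set \<Rightarrow> ('v,'e) op set \<Rightarrow> ('v,'e) op set \<Rightarrow> bool" where
  "is_wgen r s K I S = (S \<subseteq> LG r s \<and> wgen_ideal r s K S = I)"

inductive_set alg_ideal :: "('e \<Rightarrow> 'v) \<Rightarrow> ('e \<Rightarrow> 'v) \<Rightarrow> ('v,'e) op set \<Rightarrow> ('v,'e) op set \<Rightarrow> ('v,'e) op set"
  for r s K S where
    gen: "A \<in> S \<Longrightarrow> A \<in> alg_ideal r s K S"
  | ker: "A \<in> K \<Longrightarrow> A \<in> alg_ideal r s K S"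
  | add: "A \<in> alg_ideal r s K S \<Longrightarrow> B \<in> alg_ideal r s K S \<Longrightarrow> oadd A B \<in> alg_ideal r s K S"
  | scale: "A \<in> alg_ideal r s K S \<Longrightarrow> oscale c A \<in> alg_ideal r s K S"
  | lmul: "A \<in> alg_ideal r s K S \<Longrightarrow> B \<in> LG r s \<Longrightarrow> omul B A \<in> alg_ideal r s K S"
  | rmul: "A \<in> alg_ideal r s K S \<Longrightarrow> B \<in> LG r s \<Longrightarrow> omul A B \<in> alg_ideal r s K S"

definition seq_limits :: "('e \<Rightarrow> 'v) \<Rightarrow> ('e \<Rightarrow> 'v) \<Rightarrow> ('v,'e) op set \<Rightarrow> ('v,'e) op set \<Rightarrow> ('v,'e) op set" where
  "seq_limits r s K S = {T\<in>LG r s. \<exists>A :: nat \<Rightarrow> ('v,'e) op. (\<forall>k. A k \<in> S)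
       \<and> (\<forall>\<phi>\<in>Kperp r s K. (\<lambda>k. \<phi> (A k)) \<longlonglongrightarrow> \<phi> T)}"

definition ecard :: "'a set \<Rightarrow> enat" where
  "ecard S = (if finite S then enat (card S) else \<infinity>)"

definition n_generated :: "('e \<Rightarrow> 'v) \<Rightarrow> ('e \<Rightarrow> 'v) \<Rightarrow> ('v,'e) op set \<Rightarrow> ('v,'e) op set \<Rightarrow> enat \<Rightarrow> bool" where
  "n_generated r s K I n = ((\<exists>S. is_wgen r s K I S \<and> ecard S = n)
       \<and> (\<forall>S. is_wgen r s K I S \<longrightarrow> n \<le> ecard S))"

definition seq_n_generated :: "('e \<Rightarrow> 'v) \<Rightarrow> ('e \<Rightarrow> 'v) \<Rightarrow> ('v,'e) op set \<Rightarrow> ('v,'e) op set \<Rightarrow> enat \<Rightarrow> bool" where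
  "seq_n_generated r s K I n = (n_generated r s K I n \<and>
       (\<exists>S. is_wgen r s K I S \<and> ecard S = n \<and> seq_limits r s K (alg_ideal r s K S) = I))"

text \<open>Jacobson radical of the quotient L_G/K (preimage in L_G), via the
quasi-regularity characterisation: a \<in> rad iff for all b, b a is left
quasi-regular, i.e. \<exists>c. c + b a - c b a = 0 in the quotient.\<close>
definition qrad :: "('e \<Rightarrow> 'v) \<Rightarrow> ('e \<Rightarrow> 'v) \<Rightarrow> ('v,'e) op set \<Rightarrow> ('v,'e) op set" where
  "qrad r s K = {A\<in>LG r s. \<forall>B\<in>LG r s. \<exists>C\<in>LG r s.
       osub (oadd C (omul B A)) (omul C (omul B A)) \<in> K}"

end

theory Submission
  imports Defs
begin

text \<open>
  Every nest representation kills P_v for v different from x and y, and an operator whose images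
  all have zero diagonal is quasi-regular modulo K with quasi-inverse given by its own negative.
  Hence the radical consists of the A in L_G such that every \<pi>(A) is strictly lower triangular, and
  such an A agrees modulo K with its corner B = P_y A P_x.

  Read from its range, a path from x to y has a unique first edge that is not a loop at y, so B is
  the bounded weak-* limit of the partial sums of L_p (L_p)* B, where p runs through the paths u f with
  u a product of loops at y and f an edge into y with s(f) \<noteq> y. Because B starts at x \<noteq> y, the operators
  (L_p)* B stay in L_G. If s(f) = x then L_f is one of the generators, and otherwise L_f lies in K.

  For the lower bound, fewer than n operators are annihilated by a nonzero linear combination of the
  coefficients at edges from x to y; this combination is the off-diagonal entry of a nest
  representation whose kernel cuts out a proper weak-* closed subideal of the radical.
\<close>

text \<open>L_G is given only as an intersection, so its members cannot be inspected directly. Facts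
  about them are obtained from \<open>LG_induct\<close>: a WOT-closed subspace that contains the P_v
  and is stable under left multiplication by the L_f contains L_G. The obstacle to generation is
  that infinitely many edges and loops may occur: in general the Fourier series of B, ordered by
  length, has unbounded partial sums. Grouping by prefixes avoids summability methods. The prefixes
  p are pairwise incomparable, so a partial sum of pieces merely erases coordinates of B xi;
  domination by B itself then gives convergence against every normal functional, and countability of
  the edges turns the sum into a sequence. Adjoints leave L_G in general. On words followed by P_x,
  the adjoint of L_f either cancels the leading edge, gives 0, or meets the bare P_x, which it kills
  because r(f) = y differs from x.\<close>

section \<open>Summation and linear algebra preliminaries\<close>

text \<open>An unordered sum is an integral against counting measure, so Lebesgue's theorem
  applies.\<close>

lemma infsum_dominated_convergence:
  fixes f :: "nat \<Rightarrow> 'a \<Rightarrow> complex"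
  assumes "g summable_on A"
    and bound: "\<And>k w. w \<in> A \<Longrightarrow> cmod (f k w) \<le> g w"
    and lim: "\<And>w. w \<in> A \<Longrightarrow> (\<lambda>k. f k w) \<longlonglongrightarrow> h w"
  shows "(\<lambda>k. infsum (f k) A) \<longlonglongrightarrow> infsum h A"
proof -
  have h: "cmod (h w) \<le> g w" if "w \<in> A" for w
    using Lim_bounded[OF tendsto_norm[OF lim[OF that]]] bound[OF that] by auto
  have fa: "(\<lambda>w. norm (f k w)) summable_on A" for k
    using Infinite_Sum.abs_summable_on_comparison_test'[OF assms(1)] bound by blast
  have ha: "(\<lambda>w. norm (h w)) summable_on A"
    using Infinite_Sum.abs_summable_on_comparison_test'[OF assms(1)] h by blast
  have ga: "(\<lambda>w. norm (g w)) summable_on A"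
    using assms(1) summable_on_iff_abs_summable_on_real by blast
  have "(\<lambda>k. LINT w|count_space A. f k w) \<longlonglongrightarrow> (LINT w|count_space A. h w)"
  proof (rule integral_dominated_convergence)
    show "integrable (count_space A) g"
      using ga unfolding abs_summable_equivalent Infinite_Set_Sum.abs_summable_on_def .
    show "AE w in count_space A. (\<lambda>k. f k w) \<longlonglongrightarrow> h w"
      by (rule AE_I2) (simp add: lim)
    show "AE w in count_space A. cmod (f k w) \<le> g w" for k
      by (rule AE_I2) (simp add: bound)
  qed auto
  moreover have "(LINT w|count_space A. f k w) = infsum (f k) A" for k
    using infsetsum_infsum fa[of k] by (simp add: infsetsum_def abs_summable_equivalent)
  moreover have "(LINT w|count_space A. h w) = infsum h A"
    using infsetsum_infsum ha by (simp add: infsetsum_def abs_summable_equivalent)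
  ultimately show ?thesis by simp
qed

text \<open>This is the common source of the contraction estimates for \<open>Lop\<close>,
  \<open>Ladj\<close> and \<open>Pop\<close>: each of them relabels coordinates injectively and
  erases some.\<close>

lemma infsum_reindex_le:
  fixes F G :: "'a \<Rightarrow> real"
  assumes "inj_on j B" "\<And>u. u \<in> B \<Longrightarrow> F u \<le> G (j u)" "\<And>u. u \<notin> B \<Longrightarrow> F u = 0"
    "\<And>u. 0 \<le> F u" "\<And>u. 0 \<le> G u" "G summable_on UNIV"
  shows "F summable_on UNIV" "infsum F UNIV \<le> infsum G UNIV"
proof -
  have "G summable_on (j ` B)"
    using assms(6) summable_on_subset by blast
  then have Gj: "(G \<circ> j) summable_on B"
    using summable_on_reindex[OF assms(1)] by blast
  have FB: "F summable_on B"
    by (rule summable_on_comparison_test[OF Gj]) (use assms in auto)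
  then show "F summable_on UNIV"
    by (subst summable_on_cong_neutral[of B _ F F]) (use assms in auto)
  have "infsum F UNIV = infsum F B"
    by (rule infsum_cong_neutral) (use assms in auto)
  also have "\<dots> \<le> infsum (G \<circ> j) B"
    by (rule infsum_mono[OF FB Gj]) (use assms in auto)
  also have "\<dots> = infsum G (j ` B)"
    using infsum_reindex[OF assms(1)] by metis
  also have "\<dots> \<le> infsum G UNIV"
    by (rule infsum_mono2[OF \<open>G summable_on (j ` B)\<close> assms(6)]) (use assms in auto)
  finally show "infsum F UNIV \<le> infsum G UNIV" .
qed

lemma cmod_add_square_le: "(cmod (a + b))\<^sup>2 \<le> 2 * (cmod a)\<^sup>2 + 2 * (cmod b)\<^sup>2"
proof -
  have "(cmod (a + b))\<^sup>2 \<le> (cmod a + cmod b)\<^sup>2"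
    by (simp add: norm_triangle_ineq power_mono)
  also have "\<dots> \<le> 2 * (cmod a)\<^sup>2 + 2 * (cmod b)\<^sup>2"
    using sum_squares_bound[of "cmod a" "cmod b"] by (simp add: power2_sum)
  finally show ?thesis .
qed

text \<open>Gaussian elimination, by induction on the number of equations: an equation with a
  nonzero coefficient is used up together with one unknown.\<close>

lemma nontrivial_solution:
  fixes a :: "'b \<Rightarrow> 'a \<Rightarrow> complex"
  assumes "finite S" "finite E" "card S < card E"
  shows "\<exists>z. (\<exists>e\<in>E. z e \<noteq> 0) \<and> (\<forall>A\<in>S. (\<Sum>e\<in>E. z e * a A e) = 0)"
  using assms
proof (induction S arbitrary: E a rule: finite_induct)
  case empty
  then obtain e where "e \<in> E" by fastforce
  then show ?case by (intro exI[of _ "\<lambda>_. 1"]) auto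
next
  case (insert A S)
  show ?case
  proof (cases "\<forall>e\<in>E. a A e = 0")
    case True
    from insert.IH[OF insert.prems(1), of a] insert.prems(2) insert.hyps
    obtain z where "\<exists>e\<in>E. z e \<noteq> 0" "\<forall>A\<in>S. (\<Sum>e\<in>E. z e * a A e) = 0" by auto
    with True show ?thesis by (intro exI[of _ z]) auto
  next
    case False
    then obtain e0 where e0: "e0 \<in> E" "a A e0 \<noteq> 0" by blast
    define E' where "E' = E - {e0}"
    have E': "finite E'" "card S < card E'" "E = insert e0 E'" "e0 \<notin> E'"
      using insert.prems insert.hyps e0 by (auto simp: E'_def)
    \<comment> \<open>The reduced system arises by subtracting the multiple of equation
      \<open>A\<close> that clears the unknown \<open>e0\<close> from every other equation.\<close>
    obtain z where z: "\<exists>e\<in>E'. z e \<noteq> 0"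
      "\<forall>B\<in>S. (\<Sum>e\<in>E'. z e * (a B e - a B e0 * a A e / a A e0)) = 0"
      using insert.IH[OF E'(1,2), of "\<lambda>B e. a B e - a B e0 * a A e / a A e0"] by blast
    \<comment> \<open>The value of the unknown \<open>e0\<close> forced by equation
      \<open>A\<close>.\<close>
    define t where "t = - (\<Sum>e\<in>E'. z e * a A e) / a A e0"
    let ?z = "z(e0 := t)"
    have sum: "(\<Sum>e\<in>E. ?z e * a B e) = t * a B e0 + (\<Sum>e\<in>E'. z e * a B e)" for B
      using E' by (auto intro!: sum.cong)
    have "(\<Sum>e\<in>E. ?z e * a B e) = 0" if "B \<in> S" for B
    proof -
      have "0 = (\<Sum>e\<in>E'. z e * a B e - (z e * a A e) * (a B e0 / a A e0))"
        using bspec[OF z(2) that] by (simp add: right_diff_distrib mult.assoc mult.commute[of "a B e0"])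
      also have "\<dots> = (\<Sum>e\<in>E'. z e * a B e) + t * a B e0"
        by (simp add: sum_subtractf sum_distrib_right sum_divide_distrib t_def)
      finally show ?thesis unfolding sum by (simp add: add.commute)
    qed
    moreover have "(\<Sum>e\<in>E. ?z e * a A e) = 0"
      unfolding sum using e0 by (simp add: t_def)
    moreover have "\<exists>e\<in>E. ?z e \<noteq> 0"
      using z(1) E' by auto
    ultimately show ?thesis by blast
  qed
qed

section \<open>The Fock space of the graph\<close>

lemma HsI: "(\<And>w. \<not> valid r s w \<Longrightarrow> \<xi> w = 0) \<Longrightarrow> (\<lambda>w. (cmod (\<xi> w))\<^sup>2) summable_on UNIV \<Longrightarrow> \<xi> \<in> Hs r s"
  and Hs_invalid: "\<xi> \<in> Hs r s \<Longrightarrow> \<not> valid r s w \<Longrightarrow> \<xi> w = 0"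
  and Hs_summable: "\<xi> \<in> Hs r s \<Longrightarrow> (\<lambda>w. (cmod (\<xi> w))\<^sup>2) summable_on UNIV"
  by (auto simp: Hs_def)

lemma Hs_zero [simp]: "(\<lambda>w. 0) \<in> Hs r s"
  by (simp add: Hs_def)

lemma Hs_lincomb: 
  assumes "\<xi> \<in> Hs r s" "\<eta> \<in> Hs r s"
  shows "(\<lambda>w. c * \<xi> w + \<eta> w) \<in> Hs r s"
proof (rule HsI)
  have "(\<lambda>w. 2 * (cmod c)\<^sup>2 * (cmod (\<xi> w))\<^sup>2 + 2 * (cmod (\<eta> w))\<^sup>2) summable_on UNIV"
    using assms by (intro summable_on_add summable_on_cmult_right Hs_summable)
  then show "(\<lambda>w. (cmod (c * \<xi> w + \<eta> w))\<^sup>2) summable_on UNIV"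
    by (rule summable_on_comparison_test)
      (use cmod_add_square_le[of "c * \<xi> w" "\<eta> w" for w] in \<open>auto simp: norm_mult power_mult_distrib mult.assoc\<close>)
qed (use assms in \<open>auto simp: Hs_def\<close>)

lemma Hs_scale: "\<xi> \<in> Hs r s \<Longrightarrow> (\<lambda>w. c * \<xi> w) \<in> Hs r s"
  using Hs_lincomb[of \<xi> r s "\<lambda>w. 0" c] by simp

lemma Hs_add: "\<xi> \<in> Hs r s \<Longrightarrow> \<eta> \<in> Hs r s \<Longrightarrow> (\<lambda>w. \<xi> w + \<eta> w) \<in> Hs r s"
  using Hs_lincomb[of \<xi> r s \<eta> 1] by simp

lemma Hs_diff: "\<xi> \<in> Hs r s \<Longrightarrow> \<eta> \<in> Hs r s \<Longrightarrow> (\<lambda>w. \<xi> w - \<eta> w) \<in> Hs r s"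
  using Hs_lincomb[of \<eta> r s \<xi> "-1"] by simp

lemma Hs_sum: "(\<And>i. i \<in> I \<Longrightarrow> f i \<in> Hs r s) \<Longrightarrow> (\<lambda>w. \<Sum>i\<in>I. f i w) \<in> Hs r s"
  by (induction I rule: infinite_finite_induct) (auto intro: Hs_add)

definition bvec :: "('v,'e) fsg \<Rightarrow> ('v,'e) vec" where
  "bvec w = (\<lambda>u. if u = w then 1 else 0)"

lemma bvec_Hs: "valid r s w \<Longrightarrow> bvec w \<in> Hs r s"
proof (rule HsI)
  have "((\<lambda>u. (cmod (bvec w u))\<^sup>2) has_sum 1) UNIV"
    by (rule has_sum_finite_neutralI[of "{w}"]) (auto simp: bvec_def)
  then show "(\<lambda>u. (cmod (bvec w u))\<^sup>2) summable_on UNIV"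
    using has_sum_imp_summable by blast
qed (auto simp: bvec_def)

lemma inner2_bvec [simp]: "inner2 \<xi> (bvec w) = \<xi> w"
  unfolding inner2_def
  by (rule infsumI, rule has_sum_finite_neutralI[of "{w}"]) (auto simp: bvec_def)

lemma inner2_zero_right [simp]: "inner2 \<xi> (\<lambda>w. 0) = 0"
  by (simp add: inner2_def)

text \<open>The crude bound ab \<le> a^2 + b^2 replaces Cauchy-Schwarz; for square-summable
  sequences of vectors its right side is again summable, which is what normal functionals
  require.\<close>

lemma cmod_prod_summable:
  assumes "\<xi> \<in> Hs r s" "\<eta> \<in> Hs r s"
  shows "(\<lambda>w. cmod (\<xi> w) * cmod (\<eta> w)) summable_on UNIV"
    and "infsum (\<lambda>w. cmod (\<xi> w) * cmod (\<eta> w)) UNIV \<le> (nrm2 \<xi>)\<^sup>2 + (nrm2 \<eta>)\<^sup>2"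
proof -
  have le: "cmod (\<xi> w) * cmod (\<eta> w) \<le> (cmod (\<xi> w))\<^sup>2 + (cmod (\<eta> w))\<^sup>2" for w
    using sum_squares_bound[of "cmod (\<xi> w)" "cmod (\<eta> w)"]
      mult_nonneg_nonneg[OF norm_ge_zero[of "\<xi> w"] norm_ge_zero[of "\<eta> w"]] by linarith
  have sm: "(\<lambda>w. (cmod (\<xi> w))\<^sup>2 + (cmod (\<eta> w))\<^sup>2) summable_on UNIV"
    using assms by (intro summable_on_add Hs_summable)
  show 1: "(\<lambda>w. cmod (\<xi> w) * cmod (\<eta> w)) summable_on UNIV"
    by (rule summable_on_comparison_test[OF sm]) (use le in auto)
  have "infsum (\<lambda>w. cmod (\<xi> w) * cmod (\<eta> w)) UNIV \<le> infsum (\<lambda>w. (cmod (\<xi> w))\<^sup>2 + (cmod (\<eta> w))\<^sup>2) UNIV"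
    by (rule infsum_mono[OF 1 sm]) (use le in auto)
  also have "\<dots> = (nrm2 \<xi>)\<^sup>2 + (nrm2 \<eta>)\<^sup>2"
    using assms by (simp add: infsum_add Hs_summable nrm2_def infsum_nonneg)
  finally show "infsum (\<lambda>w. cmod (\<xi> w) * cmod (\<eta> w)) UNIV \<le> (nrm2 \<xi>)\<^sup>2 + (nrm2 \<eta>)\<^sup>2" .
qed

lemma inner2_summable:
  assumes "\<xi> \<in> Hs r s" "\<eta> \<in> Hs r s"
  shows "(\<lambda>w. \<xi> w * cnj (\<eta> w)) summable_on UNIV"
  by (rule abs_summable_summable, rule Infinite_Sum.abs_summable_on_comparison_test'[OF cmod_prod_summable(1)[OF assms]])
    (simp add: norm_mult)

lemma inner2_add_left:
  assumes "\<xi> \<in> Hs r s" "\<xi>' \<in> Hs r s" "\<eta> \<in> Hs r s"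
  shows "inner2 (\<lambda>w. \<xi> w + \<xi>' w) \<eta> = inner2 \<xi> \<eta> + inner2 \<xi>' \<eta>"
  unfolding inner2_def using assms
  by (subst infsum_add[symmetric]) (auto simp: inner2_summable distrib_right)

lemma vsub_Hs: "\<xi> \<in> Hs r s \<Longrightarrow> \<eta> \<in> Hs r s \<Longrightarrow> vsub \<xi> \<eta> \<in> Hs r s"
  unfolding vsub_def by (rule Hs_diff)

lemma nrm2_nonneg: "0 \<le> nrm2 \<xi>"
  by (simp add: nrm2_def infsum_nonneg)

lemma nrm2_square: "(nrm2 \<xi>)\<^sup>2 = infsum (\<lambda>w. (cmod (\<xi> w))\<^sup>2) UNIV"
  by (simp add: nrm2_def infsum_nonneg)

lemma nrm2_lincomb:
  assumes "\<xi> \<in> Hs r s" "\<eta> \<in> Hs r s"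
  shows "(nrm2 (\<lambda>w. c * \<xi> w + \<eta> w))\<^sup>2 \<le> 2 * (cmod c)\<^sup>2 * (nrm2 \<xi>)\<^sup>2 + 2 * (nrm2 \<eta>)\<^sup>2"
proof -
  have "infsum (\<lambda>w. (cmod (c * \<xi> w + \<eta> w))\<^sup>2) UNIV
      \<le> infsum (\<lambda>w. 2 * (cmod c)\<^sup>2 * (cmod (\<xi> w))\<^sup>2 + 2 * (cmod (\<eta> w))\<^sup>2) UNIV"
    using assms cmod_add_square_le[of "c * \<xi> w" "\<eta> w" for w]
    by (intro infsum_mono Hs_summable[OF Hs_lincomb] summable_on_add summable_on_cmult_right Hs_summable)
      (auto simp: norm_mult power_mult_distrib mult.assoc)
  also have "\<dots> = 2 * (cmod c)\<^sup>2 * (nrm2 \<xi>)\<^sup>2 + 2 * (nrm2 \<eta>)\<^sup>2"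
    using assms by (simp add: infsum_add summable_on_cmult_right Hs_summable infsum_cmult_right' nrm2_square)
  finally show ?thesis by (simp add: nrm2_square)
qed

section \<open>Bounded operators and the weak operator topology\<close>

lemma BndI:
  assumes "\<And>\<xi>. \<xi> \<notin> Hs r s \<Longrightarrow> T \<xi> = (\<lambda>w. 0)" "\<And>\<xi>. \<xi> \<in> Hs r s \<Longrightarrow> T \<xi> \<in> Hs r s"
    "\<And>\<xi> \<eta> c. \<xi> \<in> Hs r s \<Longrightarrow> \<eta> \<in> Hs r s \<Longrightarrow> T (\<lambda>w. c * \<xi> w + \<eta> w) = (\<lambda>w. c * T \<xi> w + T \<eta> w)"
    "\<And>\<xi>. \<xi> \<in> Hs r s \<Longrightarrow> (nrm2 (T \<xi>))\<^sup>2 \<le> C * (nrm2 \<xi>)\<^sup>2"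
  shows "T \<in> Bnd r s"
proof -
  have "nrm2 (T \<xi>) \<le> sqrt \<bar>C\<bar> * nrm2 \<xi>" if "\<xi> \<in> Hs r s" for \<xi>
  proof (rule power2_le_imp_le)
    have "C * (nrm2 \<xi>)\<^sup>2 \<le> \<bar>C\<bar> * (nrm2 \<xi>)\<^sup>2" by (intro mult_right_mono) auto
    then show "(nrm2 (T \<xi>))\<^sup>2 \<le> (sqrt \<bar>C\<bar> * nrm2 \<xi>)\<^sup>2"
      using assms(4)[OF that] by (simp add: power_mult_distrib)
  qed (simp add: nrm2_nonneg)
  then show ?thesis unfolding Bnd_def using assms by blast
qed

lemma Bnd_outside: "T \<in> Bnd r s \<Longrightarrow> \<xi> \<notin> Hs r s \<Longrightarrow> T \<xi> = (\<lambda>w. 0)"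
  and Bnd_lincomb: "T \<in> Bnd r s \<Longrightarrow> \<xi> \<in> Hs r s \<Longrightarrow> \<eta> \<in> Hs r s \<Longrightarrow>
    T (\<lambda>w. c * \<xi> w + \<eta> w) = (\<lambda>w. c * T \<xi> w + T \<eta> w)"
  by (auto simp: Bnd_def)

lemma Bnd_in_Hs: "T \<in> Bnd r s \<Longrightarrow> T \<xi> \<in> Hs r s"
  by (cases "\<xi> \<in> Hs r s") (auto simp: Bnd_def)

lemma Bnd_bound:
  assumes "T \<in> Bnd r s"
  obtains C where "0 \<le> C" "\<And>\<xi>. \<xi> \<in> Hs r s \<Longrightarrow> (nrm2 (T \<xi>))\<^sup>2 \<le> C * (nrm2 \<xi>)\<^sup>2"
proof -
  obtain C where C: "\<And>\<xi>. \<xi> \<in> Hs r s \<Longrightarrow> nrm2 (T \<xi>) \<le> C * nrm2 \<xi>"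
    using assms unfolding Bnd_def by blast
  have "(nrm2 (T \<xi>))\<^sup>2 \<le> C\<^sup>2 * (nrm2 \<xi>)\<^sup>2" if "\<xi> \<in> Hs r s" for \<xi>
    using power_mono[OF C[OF that] nrm2_nonneg] by (simp add: power_mult_distrib)
  then show ?thesis by (intro that[of "C\<^sup>2"]) auto
qed

lemma Bnd_zero: "T \<in> Bnd r s \<Longrightarrow> T (\<lambda>w. 0) = (\<lambda>w. 0)"
  using Bnd_lincomb[of T r s "\<lambda>w. 0" "\<lambda>w. 0" 1] by (auto simp: fun_eq_iff)

lemma Bnd_scale: "T \<in> Bnd r s \<Longrightarrow> \<xi> \<in> Hs r s \<Longrightarrow> T (\<lambda>w. c * \<xi> w) = (\<lambda>w. c * T \<xi> w)"
  using Bnd_lincomb[of T r s \<xi> "\<lambda>w. 0" c] by (simp add: Bnd_zero)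

lemma Bnd_add: "T \<in> Bnd r s \<Longrightarrow> \<xi> \<in> Hs r s \<Longrightarrow> \<eta> \<in> Hs r s \<Longrightarrow>
    T (\<lambda>w. \<xi> w + \<eta> w) = (\<lambda>w. T \<xi> w + T \<eta> w)"
  using Bnd_lincomb[of T r s \<xi> \<eta> 1] by simp

lemma Bnd_vsub: "T \<in> Bnd r s \<Longrightarrow> \<xi> \<in> Hs r s \<Longrightarrow> \<eta> \<in> Hs r s \<Longrightarrow> T (vsub \<xi> \<eta>) = vsub (T \<xi>) (T \<eta>)"
  using Bnd_lincomb[of T r s \<eta> \<xi> "-1"] by (simp add: vsub_def)

lemma ozero_Bnd: "ozero \<in> Bnd r s"
  by (rule BndI[of _ _ _ 0]) (auto simp: ozero_def nrm2_def)

lemma oadd_oscale_Bnd: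
  assumes T: "T \<in> Bnd r s" and S: "S \<in> Bnd r s"
  shows "oadd (oscale c T) S \<in> Bnd r s"
proof -
  obtain C D where C: "\<And>\<xi>. \<xi> \<in> Hs r s \<Longrightarrow> (nrm2 (T \<xi>))\<^sup>2 \<le> C * (nrm2 \<xi>)\<^sup>2"
    and D: "\<And>\<xi>. \<xi> \<in> Hs r s \<Longrightarrow> (nrm2 (S \<xi>))\<^sup>2 \<le> D * (nrm2 \<xi>)\<^sup>2"
    using Bnd_bound[OF T] Bnd_bound[OF S] by metis
  show ?thesis unfolding oadd_def oscale_def
  proof (rule BndI[of _ _ _ "2 * (cmod c)\<^sup>2 * C + 2 * D"])
    fix \<xi> assume \<xi>: "\<xi> \<in> Hs r s"
    have "(nrm2 (\<lambda>w. c * T \<xi> w + S \<xi> w))\<^sup>2 \<le> 2 * (cmod c)\<^sup>2 * (nrm2 (T \<xi>))\<^sup>2 + 2 * (nrm2 (S \<xi>))\<^sup>2"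
      by (rule nrm2_lincomb[OF Bnd_in_Hs[OF T] Bnd_in_Hs[OF S]])
    also have "\<dots> \<le> 2 * (cmod c)\<^sup>2 * (C * (nrm2 \<xi>)\<^sup>2) + 2 * (D * (nrm2 \<xi>)\<^sup>2)"
      by (intro add_mono mult_left_mono C D \<xi>) auto
    finally show "(nrm2 (\<lambda>w. c * T \<xi> w + S \<xi> w))\<^sup>2 \<le> (2 * (cmod c)\<^sup>2 * C + 2 * D) * (nrm2 \<xi>)\<^sup>2"
      by (simp add: algebra_simps)
  qed (auto simp: Bnd_outside[OF T] Bnd_outside[OF S] Bnd_lincomb[OF T] Bnd_lincomb[OF S] distrib_left
      mult.left_commute intro: Hs_lincomb Bnd_in_Hs T S)
qed

lemma oadd_Bnd: "T \<in> Bnd r s \<Longrightarrow> S \<in> Bnd r s \<Longrightarrow> oadd T S \<in> Bnd r s"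
  using oadd_oscale_Bnd[of T r s S 1] by (simp add: oadd_def oscale_def)

lemma oscale_Bnd: "T \<in> Bnd r s \<Longrightarrow> oscale c T \<in> Bnd r s"
  using oadd_oscale_Bnd[OF _ ozero_Bnd, of T r s c] by (simp add: oadd_def oscale_def ozero_def)

lemma omul_Bnd:
  assumes T: "T \<in> Bnd r s" and S: "S \<in> Bnd r s"
  shows "omul T S \<in> Bnd r s"
proof -
  obtain C D where C: "0 \<le> C" "\<And>\<xi>. \<xi> \<in> Hs r s \<Longrightarrow> (nrm2 (T \<xi>))\<^sup>2 \<le> C * (nrm2 \<xi>)\<^sup>2"
    and D: "\<And>\<xi>. \<xi> \<in> Hs r s \<Longrightarrow> (nrm2 (S \<xi>))\<^sup>2 \<le> D * (nrm2 \<xi>)\<^sup>2"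
    using Bnd_bound[OF T] Bnd_bound[OF S] by metis
  show ?thesis
  proof (rule BndI[of _ _ _ "C * D"])
    fix \<xi> assume \<xi>: "\<xi> \<in> Hs r s"
    show "(nrm2 (omul T S \<xi>))\<^sup>2 \<le> C * D * (nrm2 \<xi>)\<^sup>2"
      using C(2)[OF Bnd_in_Hs[OF S]] mult_left_mono[OF D[OF \<xi>] C(1)]
      by (simp add: omul_def mult.assoc) (rule order_trans)
  qed (auto simp: omul_def Bnd_outside[OF S] Bnd_zero[OF T] Bnd_lincomb[OF S] Bnd_lincomb[OF T]
      Bnd_in_Hs[OF S] Bnd_in_Hs[OF T])
qed

lemma osub_eq: "osub T S = oadd T (oscale (-1) S)"
  by (auto simp: osub_def oadd_def oscale_def)

text \<open>Deliberately weaker than a closed algebra: the sets used in inductions over L_G are cut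
  out by linear conditions and are usually not stable under products.\<close>

definition wot_subspace :: "('e \<Rightarrow> 'v) \<Rightarrow> ('e \<Rightarrow> 'v) \<Rightarrow> ('v,'e) op set \<Rightarrow> bool" where
  "wot_subspace r s M \<longleftrightarrow> M \<subseteq> Bnd r s \<and> ozero \<in> M \<and> (\<forall>A\<in>M. \<forall>B\<in>M. oadd A B \<in> M)
     \<and> (\<forall>A\<in>M. \<forall>c. oscale c A \<in> M) \<and> wot_closed r s M"

lemma wot_closedI:
  assumes "\<And>T. T \<in> Bnd r s \<Longrightarrow>
    (\<And>F \<epsilon>. finite F \<Longrightarrow> F \<subseteq> Hs r s \<times> Hs r s \<Longrightarrow> 0 < \<epsilon> \<Longrightarrow>
      \<exists>A\<in>S. \<forall>(\<xi>,\<eta>)\<in>F. cmod (inner2 (vsub (T \<xi>) (A \<xi>)) \<eta>) < \<epsilon>) \<Longrightarrow> T \<in> S"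
  shows "wot_closed r s S"
  unfolding wot_closed_def using assms by simp

lemma wot_closedD:
  assumes "wot_closed r s S" "T \<in> Bnd r s"
    "\<And>F \<epsilon>. finite F \<Longrightarrow> F \<subseteq> Hs r s \<times> Hs r s \<Longrightarrow> 0 < \<epsilon> \<Longrightarrow>
      \<exists>A\<in>S. \<forall>(\<xi>,\<eta>)\<in>F. cmod (inner2 (vsub (T \<xi>) (A \<xi>)) \<eta>) < \<epsilon>"
  shows "T \<in> S"
  using assms unfolding wot_closed_def by simp

lemma wot_closed_Inter:
  assumes "\<And>M. M \<in> \<M> \<Longrightarrow> wot_closed r s M"
  shows "wot_closed r s (\<Inter>\<M>)"
proof (rule wot_closedI, rule InterI)
  fix T M
  assume "T \<in> Bnd r s" "M \<in> \<M>"
    and *: "\<And>F \<epsilon>. finite F \<Longrightarrow> F \<subseteq> Hs r s \<times> Hs r s \<Longrightarrow> 0 < \<epsilon> \<Longrightarrow>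
      \<exists>A\<in>\<Inter>\<M>. \<forall>(\<xi>,\<eta>)\<in>F. cmod (inner2 (vsub (T \<xi>) (A \<xi>)) \<eta>) < \<epsilon>"
  show "T \<in> M"
    by (rule wot_closedD[OF assms[OF \<open>M \<in> \<M>\<close>] \<open>T \<in> Bnd r s\<close>]) (use * \<open>M \<in> \<M>\<close> in blast)
qed

lemma wot_subspace_Bnd: "wot_subspace r s (Bnd r s)"
  by (auto simp: wot_subspace_def ozero_Bnd oadd_Bnd oscale_Bnd wot_closed_def)

lemma wot_subspace_Inter:
  assumes "\<And>M. M \<in> \<M> \<Longrightarrow> wot_subspace r s M" "\<M> \<noteq> {}"
  shows "wot_subspace r s (\<Inter>\<M>)"
proof -
  have "wot_closed r s (\<Inter>\<M>)"
    using assms(1) by (intro wot_closed_Inter) (auto simp: wot_subspace_def)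
  then show ?thesis
    using assms unfolding wot_subspace_def by blast
qed

text \<open>The map sending \<open>A\<close> to \<open>C A B\<close> is WOT continuous, since <C A B
  xi, eta> = <A (B xi), D eta> with \<open>D\<close> in the role of the adjoint of
  \<open>C\<close>.\<close>

lemma wot_subspace_preimage:
  assumes M: "wot_subspace r s M" and B: "B \<in> Bnd r s" and C: "C \<in> Bnd r s"
    and D: "\<And>\<xi>. \<xi> \<in> Hs r s \<Longrightarrow> D \<xi> \<in> Hs r s"
    and adj: "\<And>\<xi> \<eta>. \<xi> \<in> Hs r s \<Longrightarrow> \<eta> \<in> Hs r s \<Longrightarrow> inner2 (C \<xi>) \<eta> = inner2 \<xi> (D \<eta>)"
  shows "wot_subspace r s {A \<in> Bnd r s. omul C (omul A B) \<in> M}" (is "wot_subspace r s ?N")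
proof -
  have lin: "omul C (omul (oadd A A') B) = oadd (omul C (omul A B)) (omul C (omul A' B))"
    if "A \<in> Bnd r s" "A' \<in> Bnd r s" for A A'
    using that by (auto simp: omul_def oadd_def fun_eq_iff Bnd_add[OF C] Bnd_in_Hs)
  have "omul C (omul (oscale c A) B) = oscale c (omul C (omul A B))" if "A \<in> Bnd r s" for A c
    using that by (auto simp: omul_def oscale_def fun_eq_iff Bnd_scale[OF C] Bnd_in_Hs)
  note lin = lin this
  have "omul C (omul ozero B) = ozero"
    by (auto simp: omul_def ozero_def Bnd_zero[OF C])
  moreover have "wot_closed r s ?N"
  proof (rule wot_closedI)
    fix T
    assume T: "T \<in> Bnd r s" and *: "\<And>F \<epsilon>. finite F \<Longrightarrow> F \<subseteq> Hs r s \<times> Hs r s \<Longrightarrow> 0 < \<epsilon> \<Longrightarrow>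
      \<exists>A\<in>?N. \<forall>(\<xi>,\<eta>)\<in>F. cmod (inner2 (vsub (T \<xi>) (A \<xi>)) \<eta>) < \<epsilon>"
    have "omul C (omul T B) \<in> M"
    proof (rule wot_closedD)
      show "wot_closed r s M" using M by (simp add: wot_subspace_def)
      show "omul C (omul T B) \<in> Bnd r s" by (intro omul_Bnd C T B)
      fix F and \<epsilon> :: real
      assume F: "finite F" "F \<subseteq> Hs r s \<times> Hs r s" "0 < \<epsilon>"
      define F' where "F' = (\<lambda>(\<xi>,\<eta>). (B \<xi>, D \<eta>)) ` F"
      have "finite F'" "F' \<subseteq> Hs r s \<times> Hs r s"
        using F by (auto simp: F'_def Bnd_in_Hs[OF B] D)
      from *[OF this F(3)] obtain A where A: "A \<in> ?N"
        and A': "\<forall>(\<xi>,\<eta>)\<in>F'. cmod (inner2 (vsub (T \<xi>) (A \<xi>)) \<eta>) < \<epsilon>" by blast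
      have "cmod (inner2 (vsub (omul C (omul T B) \<xi>) (omul C (omul A B) \<xi>)) \<eta>) < \<epsilon>"
        if "(\<xi>, \<eta>) \<in> F" for \<xi> \<eta>
      proof -
        have AB: "A \<in> Bnd r s" using A by simp
        have "vsub (omul C (omul T B) \<xi>) (omul C (omul A B) \<xi>) = C (vsub (T (B \<xi>)) (A (B \<xi>)))"
          using T AB by (simp add: omul_def Bnd_vsub[OF C] Bnd_in_Hs)
        then have "inner2 (vsub (omul C (omul T B) \<xi>) (omul C (omul A B) \<xi>)) \<eta>
            = inner2 (vsub (T (B \<xi>)) (A (B \<xi>))) (D \<eta>)"
          using adj[OF vsub_Hs[OF Bnd_in_Hs[OF T] Bnd_in_Hs[OF AB]], of \<eta>] F(2) that by auto
        moreover have "(B \<xi>, D \<eta>) \<in> F'" using that by (force simp: F'_def)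
        ultimately show ?thesis using A' by auto
      qed
      then show "\<exists>A\<in>M. \<forall>(\<xi>,\<eta>)\<in>F. cmod (inner2 (vsub (omul C (omul T B) \<xi>) (A \<xi>)) \<eta>) < \<epsilon>"
        using A by (intro bexI[of _ "omul C (omul A B)"]) auto
    qed
    then show "T \<in> ?N" using T by simp
  qed
  ultimately show ?thesis
    using M unfolding wot_subspace_def by (simp add: ozero_Bnd oadd_Bnd oscale_Bnd lin subset_iff)
qed

text \<open>Evaluation at w is the inner product with \<open>bvec w\<close>, so the set is the
  kernel of a WOT continuous functional. With the zero vector on one side it expresses that a single
  coefficient vanishes.\<close>

lemma wot_subspace_coefficients_eq:
  assumes "\<xi>1 \<in> Hs r s" "\<xi>2 \<in> Hs r s" "valid r s w1" "valid r s w2"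
  shows "wot_subspace r s {A \<in> Bnd r s. A \<xi>1 w1 = A \<xi>2 w2}" (is "wot_subspace r s ?N")
proof -
  have "wot_closed r s ?N"
  proof (rule wot_closedI)
    fix T
    assume T: "T \<in> Bnd r s" and *: "\<And>F \<epsilon>. finite F \<Longrightarrow> F \<subseteq> Hs r s \<times> Hs r s \<Longrightarrow> 0 < \<epsilon> \<Longrightarrow>
      \<exists>A\<in>?N. \<forall>(\<xi>,\<eta>)\<in>F. cmod (inner2 (vsub (T \<xi>) (A \<xi>)) \<eta>) < \<epsilon>"
    have "cmod (T \<xi>1 w1 - T \<xi>2 w2) \<le> \<epsilon>" if "0 < \<epsilon>" for \<epsilon>
    proof -
      have F: "{(\<xi>1, bvec w1), (\<xi>2, bvec w2)} \<subseteq> Hs r s \<times> Hs r s"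
        using assms by (auto intro: bvec_Hs)
      obtain A where "A \<xi>1 w1 = A \<xi>2 w2" "cmod (T \<xi>1 w1 - A \<xi>1 w1) < \<epsilon> / 2" "cmod (T \<xi>2 w2 - A \<xi>2 w2) < \<epsilon> / 2"
        using *[OF _ F, of "\<epsilon> / 2"] \<open>0 < \<epsilon>\<close> by (auto simp: vsub_def)
      then show ?thesis
        using norm_triangle_ineq4[of "T \<xi>1 w1 - A \<xi>1 w1" "T \<xi>2 w2 - A \<xi>2 w2"] by simp
    qed
    then have "cmod (T \<xi>1 w1 - T \<xi>2 w2) \<le> 0"
      by (rule field_le_epsilon[of _ 0, simplified])
    then show "T \<in> ?N" using T by simp
  qed
  then show ?thesis
    unfolding wot_subspace_def by (auto simp: ozero_Bnd oadd_Bnd oscale_Bnd) (auto simp: ozero_def oadd_def oscale_def)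
qed

section \<open>Generators of the algebra\<close>

lemma omul_assoc: "omul (omul A B) C = omul A (omul B C)"
  by (simp add: omul_def o_assoc)

lemma omul_apply: "omul A B \<xi> = A (B \<xi>)"
  by (simp add: omul_def)

lemma omul_ozero_left [simp]: "omul ozero A = ozero"
  by (auto simp: omul_def ozero_def)

lemma omul_ozero_right: "A \<in> Bnd r s \<Longrightarrow> omul A ozero = ozero"
  by (auto simp: omul_def ozero_def Bnd_zero)

definition pcons :: "'e \<Rightarrow> ('v,'e) fsg \<Rightarrow> ('v,'e) fsg" where
  "pcons f w = (case w of V v \<Rightarrow> P [f] | P es \<Rightarrow> P (f # es))"

text \<open>The paths that can be extended by f on the left. Outside this set \<open>pcons f\<close>
  sends every vertex to \<open>P [f]\<close>, so injectivity holds only after restriction.\<close>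

definition ext :: "('e \<Rightarrow> 'v) \<Rightarrow> ('e \<Rightarrow> 'v) \<Rightarrow> 'e \<Rightarrow> ('v,'e) fsg set" where
  "ext r s f = {w. valid r s w \<and> rg r w = s f}"

lemma valid_V [simp]: "valid r s (V v)"
  and valid_Nil [simp]: "\<not> valid r s (P [])"
  by (simp_all add: valid_def)

lemma rg_simps [simp]: "rg r (V v) = v" "rg r (P es) = r (hd es)"
  by (simp_all add: rg_def)

lemma valid_P_Cons: "valid r s (P (f # es)) \<longleftrightarrow> es = [] \<or> valid r s (P es) \<and> r (hd es) = s f"
proof (cases es)
  case (Cons g gs)
  have "(\<forall>i. Suc i < length (f # es) \<longrightarrow> s ((f # es) ! i) = r ((f # es) ! Suc i)) \<longleftrightarrow>
      s f = r g \<and> (\<forall>i. Suc i < length es \<longrightarrow> s (es ! i) = r (es ! Suc i))"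
    unfolding Cons by (auto simp: nth_Cons split: nat.splits)
  then show ?thesis by (auto simp: valid_def Cons)
qed (simp add: valid_def)

lemma pcons_simps [simp]: "pcons f (V v) = P [f]" "pcons f (P es) = P (f # es)"
  by (simp_all add: pcons_def)

lemma valid_pcons: "w \<in> ext r s f \<Longrightarrow> valid r s (pcons f w)"
  by (cases w) (auto simp: ext_def valid_P_Cons)

lemma rg_pcons [simp]: "rg r (pcons f w) = r f"
  by (cases w) auto

lemma valid_Cons_ext:
  assumes "valid r s (P (f # es))"
  obtains w where "w \<in> ext r s f" "P (f # es) = pcons f w" "w = (if es = [] then V (s f) else P es)"
  using assms by (cases "es = []") (auto simp: ext_def valid_P_Cons)

lemma inj_pcons: "inj_on (pcons f) (ext r s f)"
proof (rule inj_onI)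
  fix u w assume "u \<in> ext r s f" "w \<in> ext r s f" "pcons f u = pcons f w"
  then show "u = w" by (cases u; cases w) (auto simp: ext_def)
qed

lemma Lop_pcons: "\<xi> \<in> Hs r s \<Longrightarrow> w \<in> ext r s f \<Longrightarrow> Lop r s f \<xi> (pcons f w) = \<xi> w"
  using valid_pcons[of w r s f] by (cases w) (auto simp: Lop_def ext_def)

lemma Lop_off_range: "u \<notin> pcons f ` ext r s f \<Longrightarrow> Lop r s f \<xi> u = 0"
proof (rule ccontr)
  assume u: "u \<notin> pcons f ` ext r s f" and "Lop r s f \<xi> u \<noteq> 0"
  then obtain es where "u = P (f # es)" "valid r s u"
    by (auto simp: Lop_def split: if_splits fsg.splits list.splits)
  with u show False
    by (metis imageI valid_Cons_ext)
qed

lemma Lop_outside: "\<xi> \<notin> Hs r s \<Longrightarrow> Lop r s f \<xi> = (\<lambda>w. 0)"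
  by (simp add: Lop_def)

lemma Lop_V [simp]: "Lop r s f \<xi> (V v) = 0"
  by (simp add: Lop_def)

text \<open>The Hilbert space adjoint of \<open>Lop r s f\<close>. It never lies in L_G: it sends
  the basis vector of f to that of the vertex s(f), against
  \<open>LG_coefficient_vertex\<close>.\<close>

definition Ladj :: "('e \<Rightarrow> 'v) \<Rightarrow> ('e \<Rightarrow> 'v) \<Rightarrow> 'e \<Rightarrow> ('v,'e) op" where
  "Ladj r s f = (\<lambda>\<xi>. if \<xi> \<in> Hs r s then (\<lambda>w. if w \<in> ext r s f then \<xi> (pcons f w) else 0) else (\<lambda>w. 0))"

lemma Lop_Bnd: "Lop r s f \<in> Bnd r s"
proof -
  \<comment> \<open>Removing the leading edge; on the range of \<open>pcons f\<close> the value of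
    \<open>Lop r s f \<xi>\<close> at u is that of \<open>\<xi>\<close> at
    \<open>?j u\<close>.\<close>
  let ?j = "the_inv_into (ext r s f) (pcons f)"
  have j: "?j (pcons f w) = w" if "w \<in> ext r s f" for w
    using the_inv_into_f_f[OF inj_pcons that] .
  have inj: "inj_on ?j (pcons f ` ext r s f)"
    using inj_on_the_inv_into[OF inj_pcons] .
  have sq: "(\<lambda>u. (cmod (Lop r s f \<xi> u))\<^sup>2) summable_on UNIV \<and>
    infsum (\<lambda>u. (cmod (Lop r s f \<xi> u))\<^sup>2) UNIV \<le> infsum (\<lambda>u. (cmod (\<xi> u))\<^sup>2) UNIV" if "\<xi> \<in> Hs r s" for \<xi>
  proof -
    have "(cmod (Lop r s f \<xi> u))\<^sup>2 \<le> (cmod (\<xi> (?j u)))\<^sup>2" if "u \<in> pcons f ` ext r s f" for u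
      using that \<open>\<xi> \<in> Hs r s\<close> by (auto simp: Lop_pcons j)
    then show ?thesis
      using that infsum_reindex_le[OF inj, of "\<lambda>u. (cmod (Lop r s f \<xi> u))\<^sup>2" "\<lambda>u. (cmod (\<xi> u))\<^sup>2"]
      by (simp add: Lop_off_range Hs_summable)
  qed
  show ?thesis
  proof (rule BndI[of _ _ _ 1])
    fix \<xi> assume \<xi>: "\<xi> \<in> Hs r s"
    show "Lop r s f \<xi> \<in> Hs r s"
      using sq[OF \<xi>] by (intro HsI) (auto simp: Lop_def)
    show "(nrm2 (Lop r s f \<xi>))\<^sup>2 \<le> 1 * (nrm2 \<xi>)\<^sup>2"
      using sq[OF \<xi>] by (simp add: nrm2_square)
    fix \<eta> c assume \<eta>: "\<eta> \<in> Hs r s"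
    show "Lop r s f (\<lambda>w. c * \<xi> w + \<eta> w) = (\<lambda>w. c * Lop r s f \<xi> w + Lop r s f \<eta> w)"
    proof
      fix u
      show "Lop r s f (\<lambda>w. c * \<xi> w + \<eta> w) u = c * Lop r s f \<xi> u + Lop r s f \<eta> u"
        using \<xi> \<eta> by (cases "u \<in> pcons f ` ext r s f") (auto simp: Lop_pcons Lop_off_range Hs_lincomb)
    qed
  qed (simp add: Lop_outside)
qed

lemma Ladj_Bnd: "Ladj r s f \<in> Bnd r s"
proof -
  have sq: "(\<lambda>u. (cmod (Ladj r s f \<xi> u))\<^sup>2) summable_on UNIV \<and>
    infsum (\<lambda>u. (cmod (Ladj r s f \<xi> u))\<^sup>2) UNIV \<le> infsum (\<lambda>u. (cmod (\<xi> u))\<^sup>2) UNIV" if "\<xi> \<in> Hs r s" for \<xi>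
    using that infsum_reindex_le[OF inj_pcons, of r s f "\<lambda>u. (cmod (Ladj r s f \<xi> u))\<^sup>2" "\<lambda>u. (cmod (\<xi> u))\<^sup>2"]
    by (auto simp: Ladj_def Hs_summable)
  show ?thesis
  proof (rule BndI[of _ _ _ 1])
    fix \<xi> assume \<xi>: "\<xi> \<in> Hs r s"
    show "Ladj r s f \<xi> \<in> Hs r s"
      using sq[OF \<xi>] by (intro HsI) (auto simp: Ladj_def ext_def)
    show "(nrm2 (Ladj r s f \<xi>))\<^sup>2 \<le> 1 * (nrm2 \<xi>)\<^sup>2"
      using sq[OF \<xi>] by (simp add: nrm2_square)
  qed (auto simp: Ladj_def Hs_lincomb)
qed

lemma Pop_Bnd: "Pop r s v \<in> Bnd r s"
proof -
  have sq: "(\<lambda>u. (cmod (Pop r s v \<xi> u))\<^sup>2) summable_on UNIV \<and>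
    infsum (\<lambda>u. (cmod (Pop r s v \<xi> u))\<^sup>2) UNIV \<le> infsum (\<lambda>u. (cmod (\<xi> u))\<^sup>2) UNIV" if "\<xi> \<in> Hs r s" for \<xi>
    using that infsum_reindex_le[of id UNIV "\<lambda>u. (cmod (Pop r s v \<xi> u))\<^sup>2" "\<lambda>u. (cmod (\<xi> u))\<^sup>2"]
    by (auto simp: Pop_def Hs_summable)
  show ?thesis
  proof (rule BndI[of _ _ _ 1])
    fix \<xi> assume \<xi>: "\<xi> \<in> Hs r s"
    show "Pop r s v \<xi> \<in> Hs r s"
      using sq[OF \<xi>] by (intro HsI) (auto simp: Pop_def)
    show "(nrm2 (Pop r s v \<xi>))\<^sup>2 \<le> 1 * (nrm2 \<xi>)\<^sup>2"
      using sq[OF \<xi>] by (simp add: nrm2_square)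
  qed (auto simp: Pop_def Hs_lincomb)
qed

lemma inner2_Lop:
  assumes "\<xi> \<in> Hs r s" "\<eta> \<in> Hs r s"
  shows "inner2 (Lop r s f \<xi>) \<eta> = inner2 \<xi> (Ladj r s f \<eta>)"
    and "inner2 (Ladj r s f \<xi>) \<eta> = inner2 \<xi> (Lop r s f \<eta>)"
proof -
  have "inner2 (Lop r s f \<xi>) \<eta> = infsum (\<lambda>u. Lop r s f \<xi> u * cnj (\<eta> u)) (pcons f ` ext r s f)"
    unfolding inner2_def by (rule infsum_cong_neutral) (auto simp: Lop_off_range)
  also have "\<dots> = infsum (\<lambda>w. \<xi> w * cnj (Ladj r s f \<eta> w)) (ext r s f)"
    unfolding infsum_reindex[OF inj_pcons] using assms
    by (intro infsum_cong) (auto simp: Lop_pcons Ladj_def)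
  also have "\<dots> = inner2 \<xi> (Ladj r s f \<eta>)"
    unfolding inner2_def by (rule infsum_cong_neutral) (auto simp: Ladj_def)
  finally show "inner2 (Lop r s f \<xi>) \<eta> = inner2 \<xi> (Ladj r s f \<eta>)" .
  have "inner2 \<xi> (Lop r s f \<eta>) = infsum (\<lambda>u. \<xi> u * cnj (Lop r s f \<eta> u)) (pcons f ` ext r s f)"
    unfolding inner2_def by (rule infsum_cong_neutral) (auto simp: Lop_off_range)
  also have "\<dots> = infsum (\<lambda>w. Ladj r s f \<xi> w * cnj (\<eta> w)) (ext r s f)"
    unfolding infsum_reindex[OF inj_pcons] using assms
    by (intro infsum_cong) (auto simp: Lop_pcons Ladj_def)
  also have "\<dots> = inner2 (Ladj r s f \<xi>) \<eta>"
    unfolding inner2_def by (rule infsum_cong_neutral) (auto simp: Ladj_def)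
  finally show "inner2 (Ladj r s f \<xi>) \<eta> = inner2 \<xi> (Lop r s f \<eta>)" by simp
qed

lemma inner2_Pop:
  "\<xi> \<in> Hs r s \<Longrightarrow> \<eta> \<in> Hs r s \<Longrightarrow> inner2 (Pop r s v \<xi>) \<eta> = inner2 \<xi> (Pop r s v \<eta>)"
  unfolding inner2_def by (rule infsum_cong) (auto simp: Pop_def dest: Hs_invalid)

section \<open>Multiplication relations among the generators and adjoints\<close>

lemma Pop_Pop: "omul (Pop r s v) (Pop r s u) = (if v = u then Pop r s v else ozero)"
proof -
  have "omul (Pop r s v) (Pop r s u) \<xi> w = (if v = u then Pop r s v else ozero) \<xi> w" for \<xi> w
    using Bnd_in_Hs[OF Pop_Bnd, of r s u \<xi>] by (auto simp: omul_def ozero_def Pop_def)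
  then show ?thesis by blast
qed

lemma Pop_Lop: "omul (Pop r s v) (Lop r s f) = (if r f = v then Lop r s f else ozero)"
proof -
  have "omul (Pop r s v) (Lop r s f) \<xi> u = (if r f = v then Lop r s f else ozero) \<xi> u" for \<xi> u
    using Bnd_in_Hs[OF Lop_Bnd, of r s f \<xi>] valid_pcons[of _ r s f]
    by (cases "u \<in> pcons f ` ext r s f") (auto simp: omul_def ozero_def Pop_def Lop_off_range)
  then show ?thesis by blast
qed

lemma Lop_Pop: "omul (Lop r s f) (Pop r s v) = (if s f = v then Lop r s f else ozero)"
proof -
  have "omul (Lop r s f) (Pop r s v) \<xi> u = (if s f = v then Lop r s f else ozero) \<xi> u" for \<xi> u
  proof (cases "\<xi> \<in> Hs r s \<and> u \<in> pcons f ` ext r s f")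
    case True
    then show ?thesis using Bnd_in_Hs[OF Pop_Bnd, of r s v \<xi>]
      by (auto simp: omul_def Lop_pcons ozero_def) (auto simp: Pop_def ext_def)
  next
    case False
    then show ?thesis
      by (auto simp: omul_def ozero_def Lop_off_range Bnd_outside[OF Pop_Bnd] Bnd_zero[OF Lop_Bnd] Lop_outside)
  qed
  then show ?thesis by blast
qed

lemma Ladj_Lop: "omul (Ladj r s f) (Lop r s g) = (if f = g then Pop r s (s f) else ozero)"
proof -
  have "omul (Ladj r s f) (Lop r s g) \<xi> w = (if f = g then Pop r s (s f) else ozero) \<xi> w" for \<xi> w
  proof (cases "\<xi> \<in> Hs r s \<and> w \<in> ext r s f")
    case True
    have "pcons f w \<notin> pcons g ` ext r s g" if "f \<noteq> g"
      using that by (auto simp: pcons_def split: fsg.splits)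
    with True show ?thesis using Bnd_in_Hs[OF Lop_Bnd, of r s g \<xi>]
      by (auto simp: omul_def Ladj_def Lop_pcons Lop_off_range ozero_def) (auto simp: Pop_def ext_def)
  next
    case False
    then show ?thesis
      by (auto simp: omul_def Ladj_def Pop_def ozero_def Lop_outside ext_def)
  qed
  then show ?thesis by blast
qed

lemma Ladj_Pop: "r f \<noteq> v \<Longrightarrow> omul (Ladj r s f) (Pop r s v) = ozero"
  by (auto simp: omul_def Ladj_def Pop_def ozero_def fun_eq_iff)

section \<open>The free semigroupoid algebra\<close>

lemma LG_subset_Bnd: "LG r s \<subseteq> Bnd r s"
proof -
  have "Bnd r s \<in> {S. S \<subseteq> Bnd r s \<and> subalg S \<and> wot_closed r s S
      \<and> range (Lop r s) \<subseteq> S \<and> range (Pop r s) \<subseteq> S}"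
    using wot_subspace_Bnd[of r s] by (auto simp: subalg_def wot_subspace_def omul_Bnd Lop_Bnd Pop_Bnd)
  then show ?thesis unfolding LG_def by blast
qed

lemma LG_Bnd: "A \<in> LG r s \<Longrightarrow> A \<in> Bnd r s"
  using LG_subset_Bnd by blast

lemma Lop_LG: "Lop r s f \<in> LG r s" and Pop_LG: "Pop r s v \<in> LG r s"
  unfolding LG_def by blast+

lemma ozero_LG: "ozero \<in> LG r s"
  and oadd_LG: "A \<in> LG r s \<Longrightarrow> B \<in> LG r s \<Longrightarrow> oadd A B \<in> LG r s"
  and omul_LG: "A \<in> LG r s \<Longrightarrow> B \<in> LG r s \<Longrightarrow> omul A B \<in> LG r s"
  and oscale_LG: "A \<in> LG r s \<Longrightarrow> oscale c A \<in> LG r s"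
  unfolding LG_def subalg_def by blast+

lemma osub_LG: "A \<in> LG r s \<Longrightarrow> B \<in> LG r s \<Longrightarrow> osub A B \<in> LG r s"
  by (simp add: osub_eq oadd_LG oscale_LG)

lemma wot_subspace_LG: "wot_subspace r s (LG r s)"
proof -
  have "wot_closed r s (LG r s)"
    unfolding LG_def by (rule wot_closed_Inter) blast
  then show ?thesis
    using LG_subset_Bnd by (auto simp: wot_subspace_def ozero_LG oadd_LG oscale_LG)
qed

text \<open>The identity operator has to be cut off outside H_G to belong to \<open>Bnd\<close>; it
  lets the two-sided preimage lemma yield the one-sided ones.\<close>

lemma omul_Id_right:
  assumes "A \<in> Bnd r s"
  shows "omul A (\<lambda>\<xi>. if \<xi> \<in> Hs r s then \<xi> else (\<lambda>w. 0)) = A"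
  using assms by (auto simp: omul_def fun_eq_iff Bnd_outside Bnd_zero)

lemma Id_Bnd: "(\<lambda>\<xi>. if \<xi> \<in> Hs r s then \<xi> else (\<lambda>w. 0)) \<in> Bnd r s"
  by (rule BndI[of _ _ _ 1]) (auto simp: Hs_lincomb)

lemma wot_subspace_left_preimage:
  assumes "wot_subspace r s M" "C \<in> Bnd r s" "D \<in> Bnd r s"
    and "\<And>\<xi> \<eta>. \<xi> \<in> Hs r s \<Longrightarrow> \<eta> \<in> Hs r s \<Longrightarrow> inner2 (C \<xi>) \<eta> = inner2 \<xi> (D \<eta>)"
  shows "wot_subspace r s {A \<in> Bnd r s. omul C A \<in> M}"
proof -
  have "{A \<in> Bnd r s. omul C A \<in> M} = 
      {A \<in> Bnd r s. omul C (omul A (\<lambda>\<xi>. if \<xi> \<in> Hs r s then \<xi> else (\<lambda>w. 0))) \<in> M}"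
    by (auto simp: omul_Id_right)
  also have "wot_subspace r s \<dots>"
    by (rule wot_subspace_preimage[where D = D, OF assms(1) Id_Bnd assms(2) Bnd_in_Hs[OF assms(3)] assms(4)])
  finally show ?thesis .
qed

lemma wot_subspace_right_preimage:
  assumes M: "wot_subspace r s M" and B: "B \<in> Bnd r s"
  shows "wot_subspace r s {A \<in> Bnd r s. omul A B \<in> M}"
proof -
  have "omul (\<lambda>\<xi>. if \<xi> \<in> Hs r s then \<xi> else (\<lambda>w. 0)) A = A" if "A \<in> Bnd r s" for A
    using that by (auto simp: omul_def fun_eq_iff Bnd_in_Hs)
  then have "{A \<in> Bnd r s. omul A B \<in> M} = 
      {A \<in> Bnd r s. omul (\<lambda>\<xi>. if \<xi> \<in> Hs r s then \<xi> else (\<lambda>w. 0)) (omul A B) \<in> M}"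
    using omul_Bnd[OF _ B] by auto
  also have "wot_subspace r s \<dots>"
    by (rule wot_subspace_preimage[where D = "\<lambda>\<xi>. \<xi>", OF M B Id_Bnd]) auto
  finally show ?thesis .
qed

text \<open>Words grow only at the range end, so that an induction peels off exactly the edge that
  the adjoints cancel.\<close>

inductive_set words :: "('e \<Rightarrow> 'v) \<Rightarrow> ('e \<Rightarrow> 'v) \<Rightarrow> ('v,'e) op set" for r s where
  vertex: "Pop r s v \<in> words r s"
| edge: "A \<in> words r s \<Longrightarrow> omul (Lop r s f) A \<in> words r s"

text \<open>The point is that the WOT-closed subspace N spanned by the words is already an algebra,
  hence contains L_G. Multiplication is only separately WOT continuous, so one factor is passed to
  the closure at a time; minimality of N, applied to a preimage of N, replaces each density
  argument.\<close>

lemma LG_induct: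
  assumes M: "wot_subspace r s M"
    and vertex: "\<And>v. Pop r s v \<in> M"
    and edge: "\<And>A f. A \<in> M \<Longrightarrow> A \<in> LG r s \<Longrightarrow> omul (Lop r s f) A \<in> M"
  shows "LG r s \<subseteq> M"
proof -
  define N where "N = \<Inter>{M. wot_subspace r s M \<and> words r s \<subseteq> M}"
  have wB: "words r s \<subseteq> Bnd r s"
  proof
    fix A assume "A \<in> words r s" then show "A \<in> Bnd r s"
      by induction (auto intro: omul_Bnd Lop_Bnd Pop_Bnd)
  qed
  have N: "wot_subspace r s N"
    unfolding N_def using wot_subspace_Bnd wB by (intro wot_subspace_Inter) auto
  have NB: "N \<subseteq> Bnd r s" and N0: "ozero \<in> N"
    using N by (auto simp: wot_subspace_def)
  have Nmin: "N \<subseteq> M'" if "wot_subspace r s M'" "words r s \<subseteq> M'" for M'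
    unfolding N_def using that by blast
  have wN: "words r s \<subseteq> N" unfolding N_def by blast
  have LN: "omul (Lop r s f) A \<in> N" if "A \<in> N" for A f
  proof -
    have "N \<subseteq> {A \<in> Bnd r s. omul (Lop r s f) A \<in> N}"
      using wB wN by (intro Nmin wot_subspace_left_preimage[OF N Lop_Bnd Ladj_Bnd[of r s f]] inner2_Lop)
        (auto intro: words.edge)
    then show ?thesis using that by blast
  qed
  have PN: "omul (Pop r s v) A \<in> N" if "A \<in> N" for A v
  proof -
    \<comment> \<open>A projection P_v fixes or annihilates every word, according to the range of
      its leading letter.\<close>
    have "omul (Pop r s v) A \<in> N" if "A \<in> words r s" for A
      using that
    proof cases
      case (vertex u)
      then show ?thesis using wN N0 by (auto simp: Pop_Pop words.vertex)
    next
      case (edge A' f)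
      then show ?thesis using wN N0 words.edge[of A' r s f]
        by (auto simp: omul_assoc[symmetric] Pop_Lop)
    qed
    then have "N \<subseteq> {A \<in> Bnd r s. omul (Pop r s v) A \<in> N}"
      using wB by (intro Nmin wot_subspace_left_preimage[OF N Pop_Bnd Pop_Bnd[of r s v]] inner2_Pop) auto
    then show ?thesis using that by blast
  qed
  have mulN: "omul A B \<in> N" if "A \<in> N" "B \<in> N" for A B
  proof -
    \<comment> \<open>Here \<open>B\<close> is already an arbitrary element of N; the left factor is
      extended from words to N afterwards.\<close>
    have "omul A B \<in> N" if "A \<in> words r s" for A
      using that by induction (auto simp: omul_assoc intro: LN PN \<open>B \<in> N\<close>)
    then have "N \<subseteq> {A \<in> Bnd r s. omul A B \<in> N}"
      using wB NB \<open>B \<in> N\<close> by (intro Nmin wot_subspace_right_preimage[OF N]) auto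
    then show ?thesis using that by blast
  qed
  have gens: "range (Lop r s) \<subseteq> N" "range (Pop r s) \<subseteq> N"
    using wN words.edge[OF words.vertex, of r s f "s f" for f] by (auto simp: Lop_Pop words.vertex)
  have "LG r s \<subseteq> N"
    unfolding LG_def using N gens mulN by (intro Inter_lower) (auto simp: subalg_def wot_subspace_def)
  \<comment> \<open>Intersecting with L_G supplies the extra assumption
    \<open>A \<in> LG r s\<close> of the edge step.\<close>
  also have "N \<subseteq> M \<inter> LG r s"
  proof (rule Nmin)
    show "wot_subspace r s (M \<inter> LG r s)"
      using wot_subspace_Inter[of "{M, LG r s}" r s] M wot_subspace_LG by auto
    show "words r s \<subseteq> M \<inter> LG r s"
    proof
      fix A assume "A \<in> words r s" then show "A \<in> M \<inter> LG r s"
        by induction (auto simp: vertex edge Pop_LG Lop_LG omul_LG)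
    qed
  qed
  finally show ?thesis by blast
qed

lemma wot_subspace_vanishing:
  assumes "\<xi> \<in> Hs r s" "\<And>w. w \<in> W \<Longrightarrow> valid r s w"
  shows "wot_subspace r s {A \<in> Bnd r s. \<forall>w\<in>W. A \<xi> w = 0}"
proof -
  let ?S = "\<lambda>w. {A \<in> Bnd r s. A \<xi> w = A (\<lambda>w. 0) w}"
  \<comment> \<open>Inserting \<open>Bnd r s\<close> keeps the family nonempty when \<open>W\<close>
    is empty.\<close>
  have "wot_subspace r s (\<Inter>(insert (Bnd r s) (?S ` W)))"
    using assms by (intro wot_subspace_Inter) (auto intro: wot_subspace_Bnd wot_subspace_coefficients_eq)
  moreover have "\<Inter>(insert (Bnd r s) (?S ` W)) = {A \<in> Bnd r s. \<forall>w\<in>W. A \<xi> w = 0}"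
    by (auto simp: Bnd_zero)
  ultimately show ?thesis by simp
qed

section \<open>Coefficients of L_G at vertices and single edges\<close>

lemma Lop_edge: "\<xi> \<in> Hs r s \<Longrightarrow> Lop r s f \<xi> (P [e]) = (if f = e then \<xi> (V (s e)) else 0)"
  by (auto simp: Lop_def valid_P_Cons)

text \<open>An L_f puts no mass on vertices, and the P_v are diagonal.\<close>

lemma LG_coefficient_vertex:
  assumes "A \<in> LG r s" "\<zeta> \<in> Hs r s" "\<zeta> (V x) = 0"
  shows "A \<zeta> (V x) = 0"
proof -
  have "LG r s \<subseteq> {A \<in> Bnd r s. \<forall>w\<in>{V x}. A \<zeta> w = 0}"
    by (rule LG_induct[OF wot_subspace_vanishing])
      (use assms in \<open>auto simp: Pop_Bnd omul_Bnd Lop_Bnd omul_apply\<close>, auto simp: Pop_def)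
  then show ?thesis using assms(1) by auto
qed

text \<open>The basis vector of e is reached either from itself by a vertex term or from that of
  s(e) by L_e. The hypothesis on \<zeta> excludes the second way, and the vertex term acts on e by
  the same scalar as on the vertex r(e).\<close>

lemma LG_coefficient_edge:
  assumes "A \<in> LG r s" "\<zeta> \<in> Hs r s" "\<zeta> (V (s e)) = 0"
  shows "A \<zeta> (P [e]) = \<zeta> (P [e]) * A (bvec (V (r e))) (V (r e))"
proof -
  \<comment> \<open>Moving the value of \<zeta> from e to the vertex r(e) turns the claim into an
    equality of two coefficients, which is a WOT-closed condition.\<close>
  let ?\<eta> = "\<lambda>w. \<zeta> (P [e]) * bvec (V (r e)) w"
  have \<eta>: "?\<eta> \<in> Hs r s" by (intro Hs_scale bvec_Hs) simp
  have "LG r s \<subseteq> {A \<in> Bnd r s. A \<zeta> (P [e]) = A ?\<eta> (V (r e))}"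
  proof (rule LG_induct[OF wot_subspace_coefficients_eq])
    fix v
    show "Pop r s v \<in> {A \<in> Bnd r s. A \<zeta> (P [e]) = A ?\<eta> (V (r e))}"
      using assms(2) \<eta> by (simp add: Pop_Bnd) (simp add: Pop_def valid_P_Cons bvec_def)
  next
    fix A f assume "A \<in> LG r s"
    then show "omul (Lop r s f) A \<in> {A \<in> Bnd r s. A \<zeta> (P [e]) = A ?\<eta> (V (r e))}"
      using LG_coefficient_vertex[of A r s \<zeta> "s e"] assms
      by (simp add: omul_Bnd Lop_Bnd LG_Bnd omul_apply Lop_edge Bnd_in_Hs)
  qed (auto simp: assms \<eta> valid_P_Cons)
  then have "A \<zeta> (P [e]) = A ?\<eta> (V (r e))" using assms(1) by blast
  also have "\<dots> = \<zeta> (P [e]) * A (bvec (V (r e))) (V (r e))"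
    using Bnd_scale[OF LG_Bnd[OF assms(1)] bvec_Hs[of r s "V (r e)"]] by simp
  finally show ?thesis .
qed

lemma LG_coefficient_vertex_mult:
  assumes A: "A \<in> LG r s" and \<eta>: "\<eta> \<in> Hs r s"
  shows "A \<eta> (V x) = A (bvec (V x)) (V x) * \<eta> (V x)"
proof -
  let ?\<zeta> = "\<lambda>w. - \<eta> (V x) * bvec (V x) w + \<eta> w"
  have b: "bvec (V x) \<in> Hs r s" by (simp add: bvec_Hs)
  have "A ?\<zeta> (V x) = 0"
    by (rule LG_coefficient_vertex[OF A Hs_lincomb[OF b \<eta>]]) (simp add: bvec_def)
  then show ?thesis unfolding Bnd_lincomb[OF LG_Bnd[OF A] b \<eta>] by simp
qed

text \<open>This is the product rule for the (2,1) entry of lower triangular matrices, and the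
  reason why \<open>edge_rep\<close> is multiplicative.\<close>

lemma LG_coefficient_edge_mult:
  assumes A: "A \<in> LG r s" and \<eta>: "\<eta> \<in> Hs r s"
  shows "A \<eta> (P [e]) = A (bvec (V (s e))) (P [e]) * \<eta> (V (s e)) + A (bvec (V (r e))) (V (r e)) * \<eta> (P [e])"
proof -
  \<comment> \<open>Subtracting the component at s(e) makes \<open>LG_coefficient_edge\<close>
    applicable.\<close>
  let ?\<zeta> = "\<lambda>w. - \<eta> (V (s e)) * bvec (V (s e)) w + \<eta> w"
  have b: "bvec (V (s e)) \<in> Hs r s" by (simp add: bvec_Hs)
  have z: "bvec (V (s e)) (P [e]) = 0" by (simp add: bvec_def)
  have "A ?\<zeta> (P [e]) = ?\<zeta> (P [e]) * A (bvec (V (r e))) (V (r e))"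
    by (rule LG_coefficient_edge[OF A Hs_lincomb[OF b \<eta>]]) (simp add: bvec_def)
  then show ?thesis
    unfolding Bnd_lincomb[OF LG_Bnd[OF A] b \<eta>] by (simp add: z algebra_simps)
qed

section \<open>Loops at the range vertex and stability under adjoints\<close>

definition loop_words :: "('e \<Rightarrow> 'v) \<Rightarrow> ('e \<Rightarrow> 'v) \<Rightarrow> 'v \<Rightarrow> ('v,'e) fsg set" where
  "loop_words r s y = insert (V y) {P es |es. es \<noteq> [] \<and> (\<forall>g\<in>set es. r g = y \<and> s g = y)}"

lemma loop_words_simps [simp]:
  "V v \<in> loop_words r s y \<longleftrightarrow> v = y"
  "P es \<in> loop_words r s y \<longleftrightarrow> es \<noteq> [] \<and> (\<forall>g\<in>set es. r g = y \<and> s g = y)"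
  by (auto simp: loop_words_def)

lemma valid_loop_word:
  assumes "w \<in> loop_words r s y"
  shows "valid r s w"
proof -
  have "valid r s (P es)" if "es \<noteq> []" "\<forall>g\<in>set es. r g = y \<and> s g = y" for es
    using that by (induction es) (auto simp: valid_P_Cons)
  with assms show ?thesis by (auto simp: loop_words_def)
qed

lemma rg_loop_word: "w \<in> loop_words r s y \<Longrightarrow> rg r w = y"
  by (auto simp: loop_words_def)

lemma loop_word_pcons: "pcons f w \<in> loop_words r s y \<Longrightarrow> w \<in> ext r s f \<Longrightarrow> w \<in> loop_words r s y"
  by (cases w) (simp_all add: ext_def split: if_splits, metis valid_Nil)

text \<open>Every path in the range of A P_x passes through the vertex x, possibly at its very end,
  whereas a product of loops at y visits y only. All loop words are treated at once because removing
  the leading edge of one leaves another.\<close>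

lemma LG_Pop_off_loop_words:
  assumes "A \<in> LG r s" "x \<noteq> y" "w \<in> loop_words r s y"
  shows "A (Pop r s x \<xi>) w = 0"
proof -
  have PH: "Pop r s x \<xi> \<in> Hs r s" by (rule Bnd_in_Hs[OF Pop_Bnd])
  have "LG r s \<subseteq> {A \<in> Bnd r s. \<forall>w\<in>loop_words r s y. A (Pop r s x \<xi>) w = 0}" (is "_ \<subseteq> ?M")
  proof (rule LG_induct[OF wot_subspace_vanishing[OF PH valid_loop_word]])
    show "Pop r s v \<in> ?M" for v
      using assms(2) by (auto simp: Pop_Bnd dest!: rg_loop_word) (auto simp: Pop_def)
    fix A f assume A: "A \<in> ?M"
    have "Lop r s f (A (Pop r s x \<xi>)) w = 0" if "w \<in> loop_words r s y" for w
    proof (cases "w \<in> pcons f ` ext r s f")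
      case True
      then show ?thesis using A that loop_word_pcons[of f _ r s y] by (auto simp: Lop_pcons Bnd_in_Hs)
    qed (simp add: Lop_off_range)
    with A show "omul (Lop r s f) A \<in> ?M"
      by (simp add: omul_Bnd Lop_Bnd omul_apply)
  qed
  then show ?thesis using assms by blast
qed

text \<open>On a word L_g A the adjoint leaves P_{s(f)} A or 0. On a vertex word only P_x survives
  the right factor, and it is killed since r(f) differs from x; without that factor the adjoint
  itself would remain.\<close>

lemma Ladj_Pop_LG:
  assumes "A \<in> LG r s" "r f \<noteq> x"
  shows "omul (Ladj r s f) (omul A (Pop r s x)) \<in> LG r s"
proof -
  have "LG r s \<subseteq> {A \<in> Bnd r s. omul (Ladj r s f) (omul A (Pop r s x)) \<in> LG r s}" (is "_ \<subseteq> ?M")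
  proof (rule LG_induct)
    show "wot_subspace r s ?M"
      by (rule wot_subspace_preimage[where D = "Lop r s f", OF wot_subspace_LG Pop_Bnd Ladj_Bnd Bnd_in_Hs[OF Lop_Bnd] inner2_Lop(2)])
    show "Pop r s v \<in> ?M" for v
      using assms(2) by (simp add: Pop_Bnd Pop_Pop Ladj_Pop ozero_LG omul_ozero_right[OF Ladj_Bnd])
    show "omul (Lop r s g) A \<in> ?M" if "A \<in> LG r s" for A g
      using that by (simp add: omul_Bnd Lop_Bnd LG_Bnd omul_assoc)
        (simp add: omul_assoc[symmetric] Ladj_Lop, simp add: ozero_LG omul_LG Pop_LG)
  qed
  then show ?thesis using assms by blast
qed

section \<open>Decomposing an operator along prefixes\<close>

text \<open>The operator A followed by the projection onto the paths with prefix p, written as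
  L_p (L_p)* A so that L_p is visible as a factor.\<close>

fun piece :: "('e \<Rightarrow> 'v) \<Rightarrow> ('e \<Rightarrow> 'v) \<Rightarrow> 'e list \<Rightarrow> ('v,'e) op \<Rightarrow> ('v,'e) op" where
  "piece r s [] A = A"
| "piece r s (f # p) A = omul (Lop r s f) (piece r s p (omul (Ladj r s f) A))"

text \<open>The separate clause for the empty prefix is there for vertices, which are not of the
  form \<open>P q\<close>.\<close>

definition starts :: "'e list \<Rightarrow> ('v,'e) fsg \<Rightarrow> bool" where
  "starts p w \<longleftrightarrow> p = [] \<or> (\<exists>q. w = P (p @ q))"

lemma starts_pcons: "starts (f # p) (pcons g w) \<longleftrightarrow> f = g \<and> (starts p w \<or> p = [])"
  by (cases w) (auto simp: starts_def)

lemma piece_Bnd: "A \<in> Bnd r s \<Longrightarrow> piece r s p A \<in> Bnd r s"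
  by (induction p arbitrary: A) (auto intro: omul_Bnd Lop_Bnd Ladj_Bnd)

text \<open>L_p times its adjoint is the diagonal projection onto paths beginning with p, so
  \<open>piece\<close> only erases coordinates.\<close>

lemma piece_apply:
  "A \<in> Bnd r s \<Longrightarrow> piece r s p A \<xi> w = (if starts p w then A \<xi> w else 0)"
proof (induction p arbitrary: A w)
  case Nil
  then show ?case by (simp add: starts_def)
next
  case (Cons f p)
  let ?B = "omul (Ladj r s f) A"
  have B: "?B \<in> Bnd r s" using Cons.prems by (intro omul_Bnd Ladj_Bnd)
  have BH: "piece r s p ?B \<xi> \<in> Hs r s" by (rule Bnd_in_Hs[OF piece_Bnd[OF B]])
  show ?case
  proof (cases "w \<in> pcons f ` ext r s f")
    case True
    then obtain w' where w': "w' \<in> ext r s f" "w = pcons f w'" by blast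
    have "piece r s (f # p) A \<xi> w = piece r s p ?B \<xi> w'"
      using w' BH by (simp add: omul_apply Lop_pcons)
    also have "\<dots> = (if starts p w' then Ladj r s f (A \<xi>) w' else 0)"
      unfolding Cons.IH[OF B] by (simp add: omul_apply)
    also have "Ladj r s f (A \<xi>) w' = A \<xi> w"
      using w' Bnd_in_Hs[OF Cons.prems] by (simp add: Ladj_def)
    also have "starts p w' \<longleftrightarrow> starts (f # p) w"
      unfolding w'(2) starts_pcons by (auto simp: starts_def)
    finally show ?thesis .
  next
    case False
    \<comment> \<open>A list that begins with f but is not an extension by f is not a path, and
      vectors of H_G vanish there.\<close>
    have "A \<xi> w = 0" if "starts (f # p) w"
    proof -
      have "\<not> valid r s w"
        using that False valid_Cons_ext[of r s f] by (fastforce simp: starts_def)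
      then show ?thesis using Hs_invalid[OF Bnd_in_Hs[OF Cons.prems]] by blast
    qed
    then show ?thesis using False by (simp add: omul_apply Lop_off_range)
  qed
qed

text \<open>The condition A P_x = A is inherited, so adjoints can be applied one after another along
  a prefix.\<close>

lemma Ladj_LG:
  assumes "A \<in> LG r s" "omul A (Pop r s x) = A" "r f \<noteq> x"
  shows "omul (Ladj r s f) A \<in> LG r s" "omul (omul (Ladj r s f) A) (Pop r s x) = omul (Ladj r s f) A"
  using Ladj_Pop_LG[of A r s f x] assms by (simp_all add: omul_assoc)

lemma piece_LG:
  assumes "A \<in> LG r s" "omul A (Pop r s x) = A" "\<forall>g\<in>set p. r g \<noteq> x"
  shows "piece r s p A \<in> LG r s"
  using assms
proof (induction p arbitrary: A)
  case (Cons f p)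
  then show ?case using Ladj_LG[of A r s x f] by (simp add: omul_LG Lop_LG)
qed simp

text \<open>Only the last edge has to give an ideal element: the earlier edges are left factors, and
  the stripped operator is a right factor in L_G.\<close>

lemma piece_alg_ideal:
  assumes "A \<in> LG r s" "omul A (Pop r s x) = A" "\<forall>g\<in>set (us @ [f]). r g \<noteq> x"
    and "Lop r s f \<in> alg_ideal r s K S"
  shows "piece r s (us @ [f]) A \<in> alg_ideal r s K S"
  using assms
proof (induction us arbitrary: A)
  case Nil
  then show ?case using Ladj_LG[of A r s x f] by (simp add: alg_ideal.rmul)
next
  case (Cons g us)
  then show ?case using Ladj_LG[of A r s x g] by (simp add: alg_ideal.lmul Lop_LG)
qed

text \<open>Stage k has treated the prefixes with code below k. Indexing by codes rather than by
  finite subsets gives a sequence instead of a net.\<close>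

fun partial_pieces :: "('e::countable \<Rightarrow> 'v) \<Rightarrow> ('e \<Rightarrow> 'v) \<Rightarrow> 'e list set \<Rightarrow> ('v,'e) op \<Rightarrow> nat \<Rightarrow> ('v,'e) op" where
  "partial_pieces r s Q A 0 = ozero"
| "partial_pieces r s Q A (Suc k) = (if k \<in> to_nat ` Q
     then oadd (partial_pieces r s Q A k) (piece r s (from_nat k) A) else partial_pieces r s Q A k)"

text \<open>At most one prefix in \<open>Q\<close> fits w, so no coordinate is counted twice and the
  sum is a truncation of \<open>A\<close>.\<close>

lemma partial_pieces_apply:
  assumes "A \<in> Bnd r s"
    and prefix_free: "\<And>p q. p \<in> Q \<Longrightarrow> q \<in> Q \<Longrightarrow> starts p w \<Longrightarrow> starts q w \<Longrightarrow> p = q"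
  shows "partial_pieces r s Q A k \<xi> w = (if \<exists>p\<in>Q. to_nat p < k \<and> starts p w then A \<xi> w else 0)"
proof (induction k)
  case 0
  then show ?case by (simp add: ozero_def)
next
  case (Suc k)
  show ?case
  proof (cases "k \<in> to_nat ` Q")
    case True
    then obtain p where p: "p \<in> Q" "k = to_nat p" by blast
    have "(\<exists>q\<in>Q. to_nat q < Suc k \<and> starts q w) \<longleftrightarrow> starts p w \<or> (\<exists>q\<in>Q. to_nat q < k \<and> starts q w)"
      using p by (auto simp: less_Suc_eq)
    moreover have "\<not> (\<exists>q\<in>Q. to_nat q < k \<and> starts q w)" if "starts p w"
      using prefix_free[OF p(1) _ that] p by auto
    ultimately show ?thesis
      using p True Suc.IH by (auto simp: oadd_def piece_apply[OF assms(1)])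
  next
    case False
    then have "(\<exists>q\<in>Q. to_nat q < Suc k \<and> starts q w) \<longleftrightarrow> (\<exists>q\<in>Q. to_nat q < k \<and> starts q w)"
      by (auto simp: less_Suc_eq)
    then show ?thesis using False Suc.IH by simp
  qed
qed

section \<open>Weak-* continuous functionals\<close>

lemma wstar_fun_oadd:
  assumes "wstar_fun r s \<phi>" "A \<in> LG r s" "B \<in> LG r s"
  shows "\<phi> (oadd A B) = \<phi> A + \<phi> B"
proof -
  obtain xs ys where H: "\<forall>n. xs n \<in> Hs r s \<and> ys n \<in> Hs r s"
    and \<phi>: "\<And>A. A \<in> LG r s \<Longrightarrow> (\<lambda>n. inner2 (A (xs n)) (ys n)) sums \<phi> A"
    using assms(1) unfolding wstar_fun_def by blast
  have "(\<lambda>n. inner2 (A (xs n)) (ys n) + inner2 (B (xs n)) (ys n)) sums (\<phi> A + \<phi> B)"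
    by (intro sums_add \<phi> assms)
  moreover have "inner2 (A (xs n)) (ys n) + inner2 (B (xs n)) (ys n) = inner2 (oadd A B (xs n)) (ys n)" for n
    unfolding oadd_def using H assms(2,3) by (intro inner2_add_left[symmetric]) (auto intro: Bnd_in_Hs LG_Bnd)
  ultimately show ?thesis
    using \<phi>[OF oadd_LG[OF assms(2,3)]] by (simp add: sums_unique2)
qed

text \<open>Two limits are interchanged: dominated convergence over paths inside each inner product,
  and Tannery's theorem over the terms of the normal functional.\<close>

lemma wstar_fun_dominated:
  assumes "wstar_fun r s \<phi>" "\<And>k. C k \<in> LG r s" "A \<in> LG r s"
    and bound: "\<And>k \<xi> w. cmod (C k \<xi> w) \<le> cmod (A \<xi> w)"
    and lim: "\<And>\<xi> w. (\<lambda>k. C k \<xi> w) \<longlonglongrightarrow> A \<xi> w"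
  shows "(\<lambda>k. \<phi> (C k)) \<longlonglongrightarrow> \<phi> A"
proof -
  obtain xs ys where H: "\<And>n. xs n \<in> Hs r s" "\<And>n. ys n \<in> Hs r s"
    and sm: "summable (\<lambda>n. (nrm2 (xs n))\<^sup>2)" "summable (\<lambda>n. (nrm2 (ys n))\<^sup>2)"
    and \<phi>: "\<And>A. A \<in> LG r s \<Longrightarrow> (\<lambda>n. inner2 (A (xs n)) (ys n)) sums \<phi> A"
    using assms(1) unfolding wstar_fun_def by blast
  obtain D where D: "\<And>\<xi>. \<xi> \<in> Hs r s \<Longrightarrow> (nrm2 (A \<xi>))\<^sup>2 \<le> D * (nrm2 \<xi>)\<^sup>2"
    using Bnd_bound[OF LG_Bnd[OF assms(3)]] by blast
  have AH: "A (xs n) \<in> Hs r s" and CH: "C k (xs n) \<in> Hs r s" for k n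
    using Bnd_in_Hs LG_Bnd assms(2,3) by blast+
  note prods = cmod_prod_summable[OF AH H(2)]
  have bnd: "cmod (C k (xs n) w * cnj (ys n w)) \<le> cmod (A (xs n) w) * cmod (ys n w)" for k n w
    by (simp add: norm_mult mult_right_mono bound)
  \<comment> \<open>Obtained from ab \<le> a^2 + b^2 and boundedness of \<open>A\<close>; it does
    not depend on k and is summable in n.\<close>
  let ?M = "\<lambda>n. D * (nrm2 (xs n))\<^sup>2 + (nrm2 (ys n))\<^sup>2"
  have le: "cmod (inner2 (C k (xs n)) (ys n)) \<le> ?M n" for k n
  proof -
    have "cmod (inner2 (C k (xs n)) (ys n)) \<le> infsum (\<lambda>w. cmod (A (xs n) w) * cmod (ys n w)) UNIV"
      unfolding inner2_def
      by (rule norm_infsum_le[OF has_sum_infsum[OF inner2_summable[OF CH H(2)]] has_sum_infsum[OF prods(1)] bnd])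
    also have "\<dots> \<le> (nrm2 (A (xs n)))\<^sup>2 + (nrm2 (ys n))\<^sup>2" by (rule prods(2))
    finally show ?thesis using D[OF H(1)[of n]] by linarith
  qed
  have "(\<lambda>k. suminf (\<lambda>n. inner2 (C k (xs n)) (ys n))) \<longlonglongrightarrow> suminf (\<lambda>n. inner2 (A (xs n)) (ys n))"
  proof (rule tannerys_theorem[THEN conjunct2, THEN conjunct2])
    show "(\<lambda>k. inner2 (C k (xs n)) (ys n)) \<longlonglongrightarrow> inner2 (A (xs n)) (ys n)" for n
      unfolding inner2_def
      by (rule infsum_dominated_convergence[OF prods(1)[of n n]]) (auto intro!: bnd tendsto_intros lim)
    show "\<forall>\<^sub>F (n, k) in sequentially \<times>\<^sub>F sequentially. cmod (inner2 (C k (xs n)) (ys n)) \<le> ?M n"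
      using le by (simp add: case_prod_unfold)
    show "summable ?M"
      by (intro summable_add summable_mult sm)
  qed simp
  moreover have "suminf (\<lambda>n. inner2 (C k (xs n)) (ys n)) = \<phi> (C k)" for k
    using sums_unique[OF \<phi>[OF assms(2)]] by metis
  moreover have "suminf (\<lambda>n. inner2 (A (xs n)) (ys n)) = \<phi> A"
    using sums_unique[OF \<phi>[OF assms(3)]] by metis
  ultimately show ?thesis by simp
qed

lemma wstar_fun_vector:
  fixes r s :: "'e \<Rightarrow> 'v"
  assumes "\<xi> \<in> Hs r s" "\<eta> \<in> Hs r s" "\<And>A. A \<in> LG r s \<Longrightarrow> \<phi> A = inner2 (A \<xi>) \<eta>"
  shows "wstar_fun r s \<phi>"
proof -
  let ?xs = "\<lambda>n::nat. if n = 0 then \<xi> else (\<lambda>w. 0)"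
  let ?ys = "\<lambda>n::nat. if n = 0 then \<eta> else (\<lambda>w. 0)"
  have sq: "(\<lambda>n. (nrm2 (if n = (0::nat) then \<zeta> else (\<lambda>w. 0)))\<^sup>2) sums (nrm2 \<zeta>)\<^sup>2" for \<zeta> :: "('v,'e) vec"
  proof -
    have "(\<lambda>n. (nrm2 (if n = (0::nat) then \<zeta> else (\<lambda>w. 0)))\<^sup>2) = (\<lambda>n. if n = 0 then (nrm2 \<zeta>)\<^sup>2 else 0)"
      by (auto simp: nrm2_def)
    then show ?thesis using sums_single[of 0 "\<lambda>_. (nrm2 \<zeta>)\<^sup>2"] by simp
  qed
  have "(\<lambda>n. inner2 (A (?xs n)) (?ys n)) sums \<phi> A" if "A \<in> LG r s" for A
  proof -
    have "(\<lambda>n. inner2 (A (?xs n)) (?ys n)) = (\<lambda>n. if n = 0 then \<phi> A else 0)"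
      using assms(3)[OF that] by auto
    then show ?thesis using sums_single[of 0 "\<lambda>_. \<phi> A"] by simp
  qed
  moreover have "summable (\<lambda>n. (nrm2 (?xs n))\<^sup>2)" "summable (\<lambda>n. (nrm2 (?ys n))\<^sup>2)"
    by (rule sums_summable[OF sq])+
  moreover have "\<forall>n. ?xs n \<in> Hs r s \<and> ?ys n \<in> Hs r s" using assms by simp
  ultimately show ?thesis
    unfolding wstar_fun_def by (intro exI[of _ ?xs] exI[of _ ?ys] conjI ballI)
qed

section \<open>Two-dimensional nest representations\<close>

lemma matrix2_eqI:
  fixes M N :: "complex^2^2"
  assumes "M$1$1 = N$1$1" "M$1$2 = N$1$2" "M$2$1 = N$2$1" "M$2$2 = N$2$2"
  shows "M = N"
  using assms by (simp add: vec_eq_iff forall_2)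

lemma matrix2_mult:
  fixes M N :: "complex^2^2"
  shows "(M ** N)$i$j = M$i$1 * N$1$j + M$i$2 * N$2$j"
  by (simp add: matrix_matrix_mult_def sum_2)

lemma rep_oadd: "\<pi> \<in> rep_xy r s x y \<Longrightarrow> A \<in> LG r s \<Longrightarrow> B \<in> LG r s \<Longrightarrow> \<pi> (oadd A B) = \<pi> A + \<pi> B"
  and rep_oscale: "\<pi> \<in> rep_xy r s x y \<Longrightarrow> A \<in> LG r s \<Longrightarrow> \<pi> (oscale c A) $ i $ j = c * \<pi> A $ i $ j"
  and rep_omul: "\<pi> \<in> rep_xy r s x y \<Longrightarrow> A \<in> LG r s \<Longrightarrow> B \<in> LG r s \<Longrightarrow> \<pi> (omul A B) = \<pi> A ** \<pi> B"
  and rep_wstar: "\<pi> \<in> rep_xy r s x y \<Longrightarrow> wstar_fun r s (\<lambda>A. \<pi> A $ i $ j)"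
  and rep_Pop_source: "\<pi> \<in> rep_xy r s x y \<Longrightarrow> \<pi> (Pop r s x) $ 1 $ 1 = 1"
  and rep_Pop_range: "\<pi> \<in> rep_xy r s x y \<Longrightarrow> \<pi> (Pop r s y) $ 2 $ 2 = 1"
  unfolding rep_xy_def nest_rep_def Mchar_def by blast+

lemma rep_triangular: "\<pi> \<in> rep_xy r s x y \<Longrightarrow> A \<in> LG r s \<Longrightarrow> \<pi> A $ 1 $ 2 = 0"
  unfolding rep_xy_def nest_rep_def by blast

lemma rep_osub: "\<pi> \<in> rep_xy r s x y \<Longrightarrow> A \<in> LG r s \<Longrightarrow> B \<in> LG r s \<Longrightarrow> \<pi> (osub A B) = \<pi> A - \<pi> B"
  by (simp add: osub_eq rep_oadd oscale_LG vec_eq_iff rep_oscale)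

lemma rep_ozero: "\<pi> \<in> rep_xy r s x y \<Longrightarrow> \<pi> ozero = 0"
  using rep_osub[OF _ ozero_LG ozero_LG, of \<pi> r s x y] by (simp add: osub_def ozero_def)

lemma rep_omul_diag:
  "\<pi> \<in> rep_xy r s x y \<Longrightarrow> A \<in> LG r s \<Longrightarrow> B \<in> LG r s \<Longrightarrow> \<pi> (omul A B) $ i $ i = \<pi> A $ i $ i * \<pi> B $ i $ i"
  using exhaust_2[of i] by (auto simp: rep_omul matrix2_mult rep_triangular)

lemma rep_Pop_11:
  assumes "\<pi> \<in> rep_xy r s x y" "v \<noteq> x"
  shows "\<pi> (Pop r s v) $ 1 $ 1 = 0"
  using rep_omul_diag[OF assms(1) Pop_LG Pop_LG, of v x 1] assms
  by (simp add: Pop_Pop rep_ozero rep_Pop_source)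

lemma rep_Pop_22:
  assumes "\<pi> \<in> rep_xy r s x y" "v \<noteq> y"
  shows "\<pi> (Pop r s v) $ 2 $ 2 = 0"
  using rep_omul_diag[OF assms(1) Pop_LG Pop_LG, of v y 2] assms
  by (simp add: Pop_Pop rep_ozero rep_Pop_range)

text \<open>A strictly triangular idempotent is zero.\<close>

lemma rep_Pop_zero:
  assumes \<pi>: "\<pi> \<in> rep_xy r s x y" and v: "v \<noteq> x" "v \<noteq> y"
  shows "\<pi> (Pop r s v) = 0"
proof (rule matrix2_eqI)
  have "\<pi> (Pop r s v) = \<pi> (Pop r s v) ** \<pi> (Pop r s v)"
    using rep_omul[OF \<pi> Pop_LG Pop_LG, of v v] by (simp add: Pop_Pop)
  then have "\<pi> (Pop r s v) $ 2 $ 1 = \<pi> (Pop r s v) $ 2 $ 1 * \<pi> (Pop r s v) $ 1 $ 1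
      + \<pi> (Pop r s v) $ 2 $ 2 * \<pi> (Pop r s v) $ 2 $ 1"
    by (metis matrix2_mult)
  then show "\<pi> (Pop r s v) $ 2 $ 1 = 0 $ 2 $ 1"
    using v by (simp add: rep_Pop_11[OF \<pi>] rep_Pop_22[OF \<pi>])
qed (use v in \<open>simp_all add: rep_Pop_11[OF \<pi>] rep_Pop_22[OF \<pi>] rep_triangular[OF \<pi> Pop_LG]\<close>)

lemma Lop_Kxy:
  assumes "s f \<noteq> x" "s f \<noteq> y"
  shows "Lop r s f \<in> Kxy r s x y"
proof -
  have "\<pi> (Lop r s f) = 0" if "\<pi> \<in> rep_xy r s x y" for \<pi>
    using rep_omul[OF that Lop_LG Pop_LG, of f "s f"] rep_Pop_zero[OF that assms]
    by (simp add: Lop_Pop)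
  then show ?thesis by (simp add: Kxy_def Lop_LG)
qed

section \<open>The radical modulo K\<close>

definition rep_nilpotent :: "('e \<Rightarrow> 'v) \<Rightarrow> ('e \<Rightarrow> 'v) \<Rightarrow> 'v \<Rightarrow> 'v \<Rightarrow> ('v,'e) op set" where
  "rep_nilpotent r s x y = {A \<in> LG r s. \<forall>\<pi>\<in>rep_xy r s x y. \<forall>i. \<pi> A $ i $ i = 0}"

lemma Kxy_subset: "Kxy r s x y \<subseteq> rep_nilpotent r s x y"
  by (auto simp: Kxy_def rep_nilpotent_def)

text \<open>L_e = P_y L_e P_x, where P_y has zero (1,1) entry and P_x has zero (2,2) entry.\<close>

lemma Lop_rep_nilpotent:
  assumes "s e \<noteq> r e"
  shows "Lop r s e \<in> rep_nilpotent r s (s e) (r e)"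
proof -
  let ?x = "s e" and ?y = "r e"
  have "\<pi> (Lop r s e) $ i $ i = 0" if \<pi>: "\<pi> \<in> rep_xy r s ?x ?y" for \<pi> i
    using rep_omul_diag[OF \<pi> Lop_LG Pop_LG, of e ?x i] rep_omul_diag[OF \<pi> Pop_LG Lop_LG, of ?y e i]
      exhaust_2[of i] rep_Pop_11[OF \<pi>, of ?y] rep_Pop_22[OF \<pi>, of ?x] assms
    by (auto simp: Lop_Pop Pop_Lop)
  then show ?thesis by (simp add: rep_nilpotent_def Lop_LG)
qed

lemma qrad_Kxy: "qrad r s (Kxy r s x y) = rep_nilpotent r s x y"
proof (intro equalityI subsetI)
  fix A assume A: "A \<in> qrad r s (Kxy r s x y)"
  then have AL: "A \<in> LG r s" by (simp add: qrad_def)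
  have "\<pi> A $ i $ i = 0" if \<pi>: "\<pi> \<in> rep_xy r s x y" for \<pi> i
  proof (rule ccontr)
    assume a: "\<pi> A $ i $ i \<noteq> 0"
    obtain v where v: "\<pi> (Pop r s v) $ i $ i = 1"
      using rep_Pop_source[OF \<pi>] rep_Pop_range[OF \<pi>] exhaust_2[of i] by metis
    \<comment> \<open>The scaling makes the i-th diagonal entry of BA equal to 1. If c is that of C,
      then C + BA - CBA has entry c + 1 - c = 1, so it cannot lie in K.\<close>
    let ?B = "oscale (1 / \<pi> A $ i $ i) (Pop r s v)"
    have B: "?B \<in> LG r s" by (intro oscale_LG Pop_LG)
    have BA: "omul ?B A \<in> LG r s" by (intro omul_LG B AL)
    have one: "\<pi> (omul ?B A) $ i $ i = 1"
      using a v by (simp add: rep_omul_diag[OF \<pi> B AL] rep_oscale[OF \<pi> Pop_LG])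
    obtain C where C: "C \<in> LG r s" "osub (oadd C (omul ?B A)) (omul C (omul ?B A)) \<in> Kxy r s x y"
      using A B unfolding qrad_def by blast
    have "\<pi> (osub (oadd C (omul ?B A)) (omul C (omul ?B A))) = 0"
      using C(2) \<pi> by (simp add: Kxy_def)
    then have "(\<pi> C + \<pi> (omul ?B A) - \<pi> (omul C (omul ?B A))) $ i $ i = 0"
      using C(1) BA by (simp add: rep_osub[OF \<pi>] rep_oadd[OF \<pi>] oadd_LG omul_LG)
    then show False
      using C(1) BA one by (simp add: rep_omul_diag[OF \<pi> C(1) BA])
  qed
  then show "A \<in> rep_nilpotent r s x y" using AL by (simp add: rep_nilpotent_def)
next
  fix A assume A: "A \<in> rep_nilpotent r s x y"
  then have AL: "A \<in> LG r s" by (simp add: rep_nilpotent_def)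
  have "\<exists>C\<in>LG r s. osub (oadd C (omul B A)) (omul C (omul B A)) \<in> Kxy r s x y" if B: "B \<in> LG r s" for B
  proof (rule bexI)
    \<comment> \<open>With C = -T the expression C + T - CT is T^2, whose image is the square of a
      strictly triangular matrix.\<close>
    let ?T = "omul B A" and ?C = "oscale (-1) (omul B A)"
    have T: "?T \<in> LG r s" by (intro omul_LG B AL)
    show C: "?C \<in> LG r s" by (intro oscale_LG T)
    have "\<pi> (osub (oadd ?C ?T) (omul ?C ?T)) = 0" if \<pi>: "\<pi> \<in> rep_xy r s x y" for \<pi>
    proof -
      have d: "\<pi> ?T $ i $ i = 0" for i
        using A \<pi> by (simp add: rep_omul_diag[OF \<pi> B AL] rep_nilpotent_def)
      have "\<pi> (osub (oadd ?C ?T) (omul ?C ?T)) = \<pi> ?C + \<pi> ?T - \<pi> ?C ** \<pi> ?T"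
        using T C by (simp add: rep_osub[OF \<pi>] rep_oadd[OF \<pi>] rep_omul[OF \<pi> C T] oadd_LG omul_LG)
      also have "\<dots> = 0"
        using d[of 1] d[of 2]
        by (intro matrix2_eqI) (simp_all add: rep_oscale[OF \<pi> T] matrix2_mult rep_triangular[OF \<pi> T])
      finally show ?thesis .
    qed
    then show "osub (oadd ?C ?T) (omul ?C ?T) \<in> Kxy r s x y"
      using T C by (simp add: Kxy_def osub_LG oadd_LG omul_LG)
  qed
  then show "A \<in> qrad r s (Kxy r s x y)" using AL by (simp add: qrad_def)
qed

lemma rep_entry_Kperp: "\<pi> \<in> rep_xy r s x y \<Longrightarrow> (\<lambda>A. \<pi> A $ i $ j) \<in> Kperp r s (Kxy r s x y)"
  by (auto simp: Kperp_def rep_wstar Kxy_def)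

lemma q_ideal_rep_nilpotent: "q_ideal r s (Kxy r s x y) (rep_nilpotent r s x y)"
  unfolding q_ideal_def using Kxy_subset[of r s x y]
  by (auto simp: rep_nilpotent_def oadd_LG oscale_LG omul_LG rep_oadd rep_oscale rep_omul_diag)

lemma q_closed_zero:
  assumes "\<phi> \<in> Kperp r s K" "\<And>A. A \<in> J \<Longrightarrow> \<phi> A = 0"
    and "\<forall>F. finite F \<longrightarrow> F \<subseteq> Kperp r s K \<longrightarrow> (\<forall>\<epsilon>>0. \<exists>A\<in>J. \<forall>\<phi>\<in>F. cmod (\<phi> T - \<phi> A) < \<epsilon>)"
  shows "\<phi> T = 0"
proof -
  have "cmod (\<phi> T) \<le> \<epsilon>" if "0 < \<epsilon>" for \<epsilon>
    using assms(3)[rule_format, of "{\<phi>}" \<epsilon>] assms(1,2) that by fastforce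
  then have "cmod (\<phi> T) \<le> 0" by (rule field_le_epsilon[of _ 0, simplified])
  then show ?thesis by simp
qed

lemma q_closed_rep_nilpotent: "q_closed r s (Kxy r s x y) (rep_nilpotent r s x y)"
  unfolding q_closed_def
proof (intro conjI ballI impI)
  fix T assume T: "T \<in> LG r s" and *: "\<forall>F. finite F \<longrightarrow> F \<subseteq> Kperp r s (Kxy r s x y) \<longrightarrow>
    (\<forall>\<epsilon>>0. \<exists>A\<in>rep_nilpotent r s x y. \<forall>\<phi>\<in>F. cmod (\<phi> T - \<phi> A) < \<epsilon>)"
  have "\<pi> T $ i $ i = 0" if "\<pi> \<in> rep_xy r s x y" for \<pi> i
    by (rule q_closed_zero[OF rep_entry_Kperp[OF that] _ *]) (use that in \<open>auto simp: rep_nilpotent_def\<close>)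
  then show "T \<in> rep_nilpotent r s x y" using T by (simp add: rep_nilpotent_def)
qed (auto simp: rep_nilpotent_def)

lemma alg_ideal_subset:
  assumes "q_ideal r s K J" "S \<subseteq> J"
  shows "alg_ideal r s K S \<subseteq> J"
proof
  fix A assume "A \<in> alg_ideal r s K S"
  then show "A \<in> J"
    by induction (use assms in \<open>auto simp: q_ideal_def\<close>)
qed

lemma seq_limits_subset:
  assumes "q_closed r s K J" "S \<subseteq> J"
  shows "seq_limits r s K S \<subseteq> J"
proof
  fix T assume "T \<in> seq_limits r s K S"
  then obtain A where T: "T \<in> LG r s" and A: "\<And>k. A k \<in> S"
    and lim: "\<And>\<phi>. \<phi> \<in> Kperp r s K \<Longrightarrow> (\<lambda>k. \<phi> (A k)) \<longlonglongrightarrow> \<phi> T"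
    by (auto simp: seq_limits_def)
  have "\<exists>B\<in>J. \<forall>\<phi>\<in>F. cmod (\<phi> T - \<phi> B) < \<epsilon>" if F: "finite F" "F \<subseteq> Kperp r s K" and \<epsilon>: "0 < \<epsilon>" for F \<epsilon>
  proof -
    have "\<forall>\<^sub>F k in sequentially. \<forall>\<phi>\<in>F. dist (\<phi> (A k)) (\<phi> T) < \<epsilon>"
      using F \<epsilon> lim by (intro eventually_ball_finite ballI tendstoD) auto
    then obtain k where "\<forall>\<phi>\<in>F. dist (\<phi> (A k)) (\<phi> T) < \<epsilon>"
      using eventually_happens' sequentially_bot by blast
    then show ?thesis using A[of k] assms(2)
      by (intro bexI[of _ "A k"]) (auto simp: dist_norm norm_minus_commute)
  qed
  then show "T \<in> J" using assms(1) T unfolding q_closed_def by blast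
qed

section \<open>Generation by the edges from x to y\<close>

definition exit_paths :: "('e \<Rightarrow> 'v) \<Rightarrow> ('e \<Rightarrow> 'v) \<Rightarrow> 'v \<Rightarrow> 'e list set" where
  "exit_paths r s y = {us @ [f] |us f. (\<forall>g\<in>set us. r g = y \<and> s g = y) \<and> r f = y \<and> s f \<noteq> y}"

lemma exit_paths_prefix_free:
  assumes "p \<in> exit_paths r s y" "q \<in> exit_paths r s y" "starts p w" "starts q w"
  shows "p = q"
proof -
  \<comment> \<open>An exit path can be read off any list it begins: it is the maximal initial run
    of edges with source y, followed by the next edge.\<close>
  have *: "p = takeWhile (\<lambda>g. s g = y) es @ [hd (dropWhile (\<lambda>g. s g = y) es)]"
    if "p \<in> exit_paths r s y" "es = p @ t" for p es t
    using that by (auto simp: exit_paths_def takeWhile_append dropWhile_append)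
  have "p \<noteq> []" "q \<noteq> []" using assms by (auto simp: exit_paths_def)
  with assms(3,4) obtain t t' where "p @ t = q @ t'" by (auto simp: starts_def)
  with *[OF assms(1) refl, of t] *[OF assms(2) refl, of t'] show ?thesis by simp
qed

lemma exit_path_exists:
  assumes "valid r s w" "rg r w = y" "w \<notin> loop_words r s y"
  shows "\<exists>p\<in>exit_paths r s y. starts p w"
proof -
  have *: "\<exists>p\<in>exit_paths r s y. \<exists>q. es = p @ q" 
    if "valid r s (P es)" "r (hd es) = y" "\<not> (\<forall>g\<in>set es. r g = y \<and> s g = y)" for es
    using that
  proof (induction es)
    case (Cons f es)
    show ?case
    proof (cases "s f = y")
      case False
      then have "[f] \<in> exit_paths r s y" using Cons.prems by (force simp: exit_paths_def)
      then show ?thesis by (intro bexI[of _ "[f]"]) auto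
    next
      case True
      \<comment> \<open>Otherwise the whole list would be the single loop f.\<close>
      then have "es \<noteq> []" using Cons.prems by auto
      then have "\<exists>p\<in>exit_paths r s y. \<exists>q. es = p @ q"
        using Cons.prems True by (intro Cons.IH) (auto simp: valid_P_Cons)
      then obtain p q where p: "p \<in> exit_paths r s y" "es = p @ q" by blast
      from p(1) obtain us g where "p = us @ [g]" "\<forall>g\<in>set us. r g = y \<and> s g = y" "r g = y" "s g \<noteq> y"
        by (auto simp: exit_paths_def)
      then have "f # p \<in> exit_paths r s y"
        using True Cons.prems unfolding exit_paths_def by (intro CollectI exI[of _ "f # us"] exI[of _ g]) auto
      then show ?thesis using p(2) by (intro bexI[of _ "f # p"]) auto
    qed
  qed simp
  show ?thesis
  proof (cases w)
    case (V v)
    then show ?thesis using assms by (auto simp: loop_words_def)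
  next
    case (P es)
    then have "es \<noteq> []" using assms(1) by auto
    then show ?thesis using assms P *[of es] by (auto simp: loop_words_def starts_def)
  qed
qed

text \<open>The images of P_x and P_y may have nonzero (2,1) entries, but in the product these meet
  the zero diagonal of the image of \<open>A\<close>; its (2,1) entry is multiplied by 1 on both
  sides.\<close>

lemma corner_in_Kxy:
  assumes "x \<noteq> y" and A: "A \<in> rep_nilpotent r s x y"
  shows "osub A (omul (Pop r s y) (omul A (Pop r s x))) \<in> Kxy r s x y"
proof -
  have AL: "A \<in> LG r s" using A by (simp add: rep_nilpotent_def)
  have "\<pi> (osub A (omul (Pop r s y) (omul A (Pop r s x)))) = 0" if \<pi>: "\<pi> \<in> rep_xy r s x y" for \<pi>
  proof -
    have d: "\<pi> A $ 1 $ 1 = 0" "\<pi> A $ 2 $ 2 = 0"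
      using A \<pi> by (auto simp: rep_nilpotent_def)
    have "\<pi> (osub A (omul (Pop r s y) (omul A (Pop r s x)))) = \<pi> A - \<pi> (Pop r s y) ** (\<pi> A ** \<pi> (Pop r s x))"
      using AL by (simp add: rep_osub[OF \<pi>] rep_omul[OF \<pi>] omul_LG Pop_LG)
    also have "\<dots> = 0"
      using assms(1) d
      by (intro matrix2_eqI) (simp_all add: matrix2_mult rep_triangular[OF \<pi>] AL Pop_LG
          rep_Pop_source[OF \<pi>] rep_Pop_range[OF \<pi>] rep_Pop_11[OF \<pi>])
    finally show ?thesis .
  qed
  then show ?thesis using AL by (simp add: Kxy_def osub_LG omul_LG Pop_LG)
qed

lemma rep_nilpotent_subset_seq_limits:
  fixes r s :: "'e::countable \<Rightarrow> 'v"
  assumes xy: "x \<noteq> y"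
  shows "rep_nilpotent r s x y \<subseteq> seq_limits r s (Kxy r s x y)
    (alg_ideal r s (Kxy r s x y) (Lop r s ` {e. s e = x \<and> r e = y}))" (is "_ \<subseteq> seq_limits r s ?K ?I")
proof
  fix A assume A: "A \<in> rep_nilpotent r s x y"
  then have AL: "A \<in> LG r s" by (simp add: rep_nilpotent_def)
  define A' where "A' = omul (Pop r s y) (omul A (Pop r s x))"
  have A'L: "A' \<in> LG r s" unfolding A'_def by (intro omul_LG Pop_LG AL)
  have A'P: "omul A' (Pop r s x) = A'" unfolding A'_def by (simp add: omul_assoc Pop_Pop)
  let ?Q = "exit_paths r s y"
  let ?C = "partial_pieces r s ?Q A'"
  have Qx: "r g \<noteq> x" if "p \<in> ?Q" "g \<in> set p" for p g
    using that xy by (auto simp: exit_paths_def)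
  have piece: "piece r s p A' \<in> LG r s \<inter> ?I" if "p \<in> ?Q" for p
  proof -
    obtain us f where p: "p = us @ [f]" "r f = y" "s f \<noteq> y"
      using \<open>p \<in> ?Q\<close> by (auto simp: exit_paths_def)
    have "Lop r s f \<in> ?I"
    proof (cases "s f = x")
      case True
      then show ?thesis using p by (intro alg_ideal.gen) auto
    next
      case False
      then show ?thesis using p by (intro alg_ideal.ker Lop_Kxy) auto
    qed
    moreover have "\<forall>g\<in>set p. r g \<noteq> x" using Qx[OF that] by blast
    ultimately show ?thesis
      using p(1) piece_LG[OF A'L A'P] piece_alg_ideal[OF A'L A'P] by blast
  qed
  have C: "?C k \<in> LG r s \<inter> ?I" for k
  proof (induction k)
    case 0
    have "ozero \<in> ?K" by (simp add: Kxy_def ozero_LG rep_ozero)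
    then show ?case by (simp add: ozero_LG alg_ideal.ker)
  next
    case (Suc k)
    then show ?case using piece by (auto simp: oadd_LG alg_ideal.add)
  qed
  \<comment> \<open>The pieces exhaust \<open>A'\<close>: P_y removes every path with another range,
    and the remaining paths without an exit prefix are loop words.\<close>
  have off: "A' \<xi> w = 0" if "\<not> (\<exists>p\<in>?Q. starts p w)" for \<xi> w
  proof (cases "valid r s w \<and> rg r w = y")
    case True
    then have "w \<in> loop_words r s y" using that exit_path_exists[of r s w y] by auto
    then have "A (Pop r s x \<xi>) w = 0" by (rule LG_Pop_off_loop_words[OF AL xy])
    then show ?thesis by (simp add: A'_def omul_apply Pop_def)
  next
    case False
    then show ?thesis by (auto simp: A'_def omul_apply Pop_def)
  qed
  have Capp: "?C k \<xi> w = (if \<exists>p\<in>?Q. to_nat p < k \<and> starts p w then A' \<xi> w else 0)" for k \<xi> w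
    by (rule partial_pieces_apply[OF LG_Bnd[OF A'L] exit_paths_prefix_free])
  have lim: "(\<lambda>k. ?C k \<xi> w) \<longlonglongrightarrow> A' \<xi> w" for \<xi> w
  proof (cases "\<exists>p\<in>?Q. starts p w")
    case True
    then obtain p where p: "p \<in> ?Q" "starts p w" by blast
    have "\<forall>\<^sub>F k in sequentially. ?C k \<xi> w = A' \<xi> w"
      using eventually_gt_at_top[of "to_nat p"] by eventually_elim (use p in \<open>auto simp: Capp\<close>)
    then show ?thesis by (rule tendsto_eventually)
  next
    case False
    then show ?thesis using off[OF False] by (auto simp: Capp)
  qed
  \<comment> \<open>The part of \<open>A\<close> lost in passing to the corner lies in K, hence in
    the ideal; adding it to every term moves the limit from \<open>A'\<close> to
    \<open>A\<close>.\<close>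
  let ?D = "osub A A'"
  have DK: "?D \<in> ?K" using corner_in_Kxy[OF xy A] by (simp add: A'_def)
  have DL: "?D \<in> LG r s" by (intro osub_LG AL A'L)
  have split: "A = oadd ?D A'" by (auto simp: oadd_def osub_def)
  have "(\<lambda>k. \<phi> (oadd ?D (?C k))) \<longlonglongrightarrow> \<phi> A" if "\<phi> \<in> Kperp r s ?K" for \<phi>
  proof -
    have \<phi>: "wstar_fun r s \<phi>" using that by (simp add: Kperp_def)
    have "(\<lambda>k. \<phi> (?C k)) \<longlonglongrightarrow> \<phi> A'"
    proof (rule wstar_fun_dominated[OF \<phi> _ A'L _ lim])
      show "?C k \<in> LG r s" for k using C by blast
      show "cmod (?C k \<xi> w) \<le> cmod (A' \<xi> w)" for k \<xi> w by (simp add: Capp)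
    qed
    then have "(\<lambda>k. \<phi> ?D + \<phi> (?C k)) \<longlonglongrightarrow> \<phi> ?D + \<phi> A'" by (intro tendsto_intros)
    moreover have "\<phi> A = \<phi> ?D + \<phi> A'"
      using wstar_fun_oadd[OF \<phi> DL A'L] split by simp
    moreover have "\<phi> (oadd ?D (?C k)) = \<phi> ?D + \<phi> (?C k)" for k
      using wstar_fun_oadd[OF \<phi> DL] C by blast
    ultimately show ?thesis by simp
  qed
  moreover have "oadd ?D (?C k) \<in> ?I" for k
    using C[of k] by (intro alg_ideal.add alg_ideal.ker[OF DK]) auto
  ultimately show "A \<in> seq_limits r s ?K ?I"
    unfolding seq_limits_def using AL by (intro CollectI conjI exI[of _ "\<lambda>k. oadd ?D (?C k)"]) auto
qed

section \<open>The number of generators\<close>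

text \<open>The diagonal entries are the vector states at the vertices x and y. The (2,1) entry is
  <A xi_x, eta> with eta the sum of conj(z_e) xi_e, so z prescribes the values on the L_e with e in
  \<open>E\<close>.\<close>

definition edge_rep :: "'v \<Rightarrow> 'v \<Rightarrow> 'e set \<Rightarrow> ('e \<Rightarrow> complex) \<Rightarrow> ('v,'e) op \<Rightarrow> complex^2^2" where
  "edge_rep x y E z A = (\<chi> i j. if i = 1 then if j = 1 then A (bvec (V x)) (V x) else 0
     else if j = 1 then \<Sum>e\<in>E. z e * A (bvec (V x)) (P [e]) else A (bvec (V y)) (V y))"

lemma edge_rep_entries [simp]:
  "edge_rep x y E z A $ 1 $ 1 = A (bvec (V x)) (V x)"
  "edge_rep x y E z A $ 1 $ 2 = 0"
  "edge_rep x y E z A $ 2 $ 1 = (\<Sum>e\<in>E. z e * A (bvec (V x)) (P [e]))"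
  "edge_rep x y E z A $ 2 $ 2 = A (bvec (V y)) (V y)"
  by (simp_all add: edge_rep_def)

lemma edge_rep_in_rep_xy:
  fixes r s :: "'e \<Rightarrow> 'v"
  assumes xy: "x \<noteq> y" and E: "finite E" "E \<subseteq> {e. s e = x \<and> r e = y}" "e0 \<in> E" "z e0 \<noteq> 0"
  shows "edge_rep x y E z \<in> rep_xy r s x y"
proof -
  let ?\<pi> = "edge_rep x y E z :: ('v,'e) op \<Rightarrow> complex^2^2"
  have bx: "bvec (V v) \<in> Hs r s" for v by (simp add: bvec_Hs)
  have add: "?\<pi> (oadd A B) = ?\<pi> A + ?\<pi> B" for A B
    by (rule matrix2_eqI) (simp_all add: oadd_def algebra_simps sum.distrib)
  have scale: "?\<pi> (oscale c A) $ i $ j = c * ?\<pi> A $ i $ j" for c A i j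
    using exhaust_2[of i] exhaust_2[of j] by (auto simp: oscale_def sum_distrib_left mult.left_commute)
  have mul: "?\<pi> (omul A B) = ?\<pi> A ** ?\<pi> B" if A: "A \<in> LG r s" and B: "B \<in> LG r s" for A B
  proof -
    have BH: "B \<xi> \<in> Hs r s" for \<xi> by (rule Bnd_in_Hs[OF LG_Bnd[OF B]])
    have v: "omul A B (bvec (V v)) (V v) = A (bvec (V v)) (V v) * B (bvec (V v)) (V v)" for v
      unfolding omul_apply by (rule LG_coefficient_vertex_mult[OF A BH])
    have "omul A B (bvec (V x)) (P [e]) = A (bvec (V x)) (P [e]) * B (bvec (V x)) (V x)
        + A (bvec (V y)) (V y) * B (bvec (V x)) (P [e])" if "e \<in> E" for e
      using LG_coefficient_edge_mult[OF A BH, of "bvec (V x)" e] that E(2) by (auto simp: omul_apply)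
    \<comment> \<open>The sum over e respects the product rule because all edges in \<open>E\<close>
      share the source x and the range y.\<close>
    then have "(\<Sum>e\<in>E. z e * omul A B (bvec (V x)) (P [e])) =
        (\<Sum>e\<in>E. z e * A (bvec (V x)) (P [e])) * B (bvec (V x)) (V x)
        + A (bvec (V y)) (V y) * (\<Sum>e\<in>E. z e * B (bvec (V x)) (P [e]))"
      by (simp add: sum.distrib distrib_left sum_distrib_left sum_distrib_right mult.assoc mult.left_commute)
    then show ?thesis by (intro matrix2_eqI) (simp_all add: matrix2_mult v)
  qed
  have wstar: "wstar_fun r s (\<lambda>A. ?\<pi> A $ i $ j)" for i j
  proof -
    have v: "wstar_fun r s (\<lambda>A. A (bvec (V v)) (V v))" for v
      by (rule wstar_fun_vector[OF bx bx[of v]]) simp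
    \<comment> \<open>The conjugates compensate for \<open>inner2\<close> being conjugate linear in
      its second argument.\<close>
    let ?\<eta> = "\<lambda>w. \<Sum>e\<in>E. cnj (z e) * bvec (P [e]) w"
    have \<eta>: "?\<eta> \<in> Hs r s"
      by (intro Hs_sum Hs_scale bvec_Hs) (simp add: valid_P_Cons)
    have inner: "inner2 \<xi> ?\<eta> = (\<Sum>e\<in>E. z e * \<xi> (P [e]))" for \<xi> :: "('v,'e) vec"
    proof -
      have hs: "((\<lambda>w. \<xi> w * cnj (?\<eta> w)) has_sum (\<Sum>w\<in>(\<lambda>e. P [e]) ` E. \<xi> w * cnj (?\<eta> w))) UNIV"
        using E(1) by (intro has_sum_finite_neutralI) (auto simp: bvec_def intro!: sum.neutral)
      have eq: "(\<Sum>w\<in>(\<lambda>e. P [e]) ` E. \<xi> w * cnj (?\<eta> w)) = (\<Sum>e\<in>E. z e * \<xi> (P [e]))"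
        using E(1) by (subst sum.reindex) (auto simp: inj_on_def bvec_def if_distrib mult.commute cong: if_cong)
      show ?thesis unfolding inner2_def by (rule infsumI[OF hs[unfolded eq]])
    qed
    have "wstar_fun r s (\<lambda>A. \<Sum>e\<in>E. z e * A (bvec (V x)) (P [e]))"
      by (rule wstar_fun_vector[OF bx \<eta>]) (simp add: inner)
    moreover have "wstar_fun r s (\<lambda>A. 0)"
      by (rule wstar_fun_vector[OF Hs_zero Hs_zero]) simp
    ultimately show ?thesis using v exhaust_2[of i] exhaust_2[of j] by auto
  qed
  have P: "Pop r s u (bvec (V v)) w = (if u = v \<and> w = V v then 1 else 0)" for u v w
    using bx by (auto simp: Pop_def bvec_def)
  have L: "Lop r s e0 (bvec (V v)) (P [e]) = (if e = e0 \<and> v = s e0 then 1 else 0)" for v e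
    using bx by (auto simp: Lop_edge) (auto simp: bvec_def)
  have onto: "?\<pi> ` LG r s = {M. M $ 1 $ 2 = 0}"
  proof (intro equalityI subsetI)
    fix M :: "complex^2^2" assume M: "M \<in> {M. M $ 1 $ 2 = 0}"
    \<comment> \<open>P_x and P_y supply the diagonal; L_{e0} has the single nonzero entry z_{e0} at
      (2,1), hence the division.\<close>
    let ?A = "oadd (oscale (M$1$1) (Pop r s x))
      (oadd (oscale (M$2$2) (Pop r s y)) (oscale (M$2$1 / z e0) (Lop r s e0)))"
    have "s e0 = x" using E by blast
    then have "z e * (c * Lop r s e0 (bvec (V x)) (P [e])) = (if e = e0 then z e0 * c else 0)" for e c
      by (simp add: L)
    then have "(\<Sum>e\<in>E. z e * (c * Lop r s e0 (bvec (V x)) (P [e]))) = z e0 * c" for c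
      using E by simp
    from this[of "M$2$1 / z e0"] have "M = ?\<pi> ?A"
      unfolding add using M E xy by (intro matrix2_eqI) (simp_all add: oscale_def P)
    moreover have "?A \<in> LG r s" by (intro oadd_LG oscale_LG Pop_LG Lop_LG)
    ultimately show "M \<in> ?\<pi> ` LG r s" by blast
  qed auto
  have "nest_rep r s ?\<pi>"
    unfolding nest_rep_def using wstar onto by (simp add: add scale mul)
  moreover have "Mchar r s x (\<lambda>A. ?\<pi> A $ 1 $ 1)" "Mchar r s y (\<lambda>A. ?\<pi> A $ 2 $ 2)"
    unfolding Mchar_def using wstar[of 1 1] wstar[of 2 2]
    by (simp_all add: add mul matrix2_mult P oscale_def)
  ultimately show ?thesis by (simp add: rep_xy_def)
qed

lemma generators_lower_bound:
  assumes xy: "x \<noteq> y" and S: "is_wgen r s (Kxy r s x y) (rep_nilpotent r s x y) S"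
  shows "ecard {e. s e = x \<and> r e = y} \<le> ecard S"
proof (rule ccontr)
  let ?E = "{e. s e = x \<and> r e = y}" and ?K = "Kxy r s x y" and ?R = "rep_nilpotent r s x y"
  assume "\<not> ?thesis"
  then have fS: "finite S" and less: "ecard S < ecard ?E"
    by (auto simp: ecard_def split: if_splits)
  \<comment> \<open>A finite set of edges, even if there are infinitely many, so that the linear
    combination is a finite sum.\<close>
  obtain E where E: "finite E" "E \<subseteq> ?E" "card S < card E"
  proof (cases "finite ?E")
    case True
    then show ?thesis using less fS that[of ?E] by (auto simp: ecard_def)
  next
    case False
    then obtain E where "E \<subseteq> ?E" "card E = Suc (card S)" "finite E"
      using infinite_arbitrarily_large by blast
    then show ?thesis using that by auto
  qed
  obtain z e0 where z: "e0 \<in> E" "z e0 \<noteq> 0" "\<forall>A\<in>S. (\<Sum>e\<in>E. z e * A (bvec (V x)) (P [e])) = 0"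
    using nontrivial_solution[OF fS E(1,3), of "\<lambda>A e. A (bvec (V x)) (P [e])"] by blast
  let ?\<pi> = "edge_rep x y E z"
  have \<pi>: "?\<pi> \<in> rep_xy r s x y"
    using edge_rep_in_rep_xy[of x y E s r e0 z] xy E z by blast
  define J where "J = {A \<in> ?R. ?\<pi> A = 0}"
  have RL: "?R \<subseteq> LG r s" by (auto simp: rep_nilpotent_def)
  have "q_ideal r s ?K J"
    using q_ideal_rep_nilpotent[of r s x y] RL \<pi> unfolding q_ideal_def J_def
    by (auto simp: rep_oadd[OF \<pi>] rep_omul[OF \<pi>] vec_eq_iff rep_oscale[OF \<pi>] subset_iff Kxy_def
        matrix_matrix_mult_def)
  moreover have "q_closed r s ?K J"
    unfolding q_closed_def
  proof (intro conjI ballI impI)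
    fix T assume T: "T \<in> LG r s" and *: "\<forall>F. finite F \<longrightarrow> F \<subseteq> Kperp r s ?K \<longrightarrow>
      (\<forall>\<epsilon>>0. \<exists>A\<in>J. \<forall>\<phi>\<in>F. cmod (\<phi> T - \<phi> A) < \<epsilon>)"
    have "?\<pi> T $ i $ j = 0" for i j
      by (rule q_closed_zero[OF rep_entry_Kperp[OF \<pi>] _ *]) (simp add: J_def)
    then have "?\<pi> T = 0" by (simp add: vec_eq_iff)
    moreover have "J \<subseteq> ?R" by (auto simp: J_def)
    then have "T \<in> ?R"
      using q_closed_rep_nilpotent[of r s x y] T * unfolding q_closed_def by (meson subsetD)
    ultimately show "T \<in> J" by (simp add: J_def)
  qed (use RL in \<open>auto simp: J_def\<close>)
  moreover have "S \<subseteq> J"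
  proof
    fix A assume A: "A \<in> S"
    have "S \<subseteq> ?R" using S unfolding is_wgen_def wgen_ideal_def by blast
    then have AR: "A \<in> ?R" using A by blast
    then have "?\<pi> A $ i $ i = 0" for i using \<pi> by (auto simp: rep_nilpotent_def)
    from this[of 1] this[of 2] have "?\<pi> A = 0"
      using z(3) A by (intro matrix2_eqI) auto
    then show "A \<in> J" using AR by (simp add: J_def)
  qed
  ultimately have "?R \<subseteq> J"
    using S unfolding is_wgen_def wgen_ideal_def by blast
  \<comment> \<open>The contradiction comes from L_{e0}: it lies in the radical, but its (2,1) entry
    is z_{e0}, which is nonzero.\<close>
  moreover have e0: "s e0 = x" "r e0 = y" using z E by auto
  moreover have "Lop r s e0 \<in> ?R" using Lop_rep_nilpotent[of s e0 r] xy e0 by simp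
  ultimately have "?\<pi> (Lop r s e0) = 0" unfolding J_def by blast
  then have "?\<pi> (Lop r s e0) $ 2 $ 1 = 0" by (simp del: edge_rep_entries)
  moreover have "bvec (V x) \<in> Hs r s" by (simp add: bvec_Hs)
  then have "z e * Lop r s e0 (bvec (V x)) (P [e]) = (if e = e0 then z e0 else 0)" for e
    using e0 by (auto simp: Lop_edge) (auto simp: bvec_def)
  ultimately show False using z E by simp
qed

text \<open>Distinct edges must give distinct operators for the generating set to have n
  elements.\<close>

lemma inj_Lop: "inj (Lop r s)"
proof (rule injI)
  fix e f assume eq: "Lop r s e = Lop r s f"
  have "bvec (V (s e)) \<in> Hs r s" by (simp add: bvec_Hs)
  then have "Lop r s e (bvec (V (s e))) (P [e]) = 1" "Lop r s f (bvec (V (s e))) (P [e]) = (if f = e then 1 else 0)"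
    by (simp_all add: Lop_edge bvec_def)
  with eq show "e = f" by (metis zero_neq_one)
qed

theorem theorem3p7:
  fixes r s :: "'e::countable \<Rightarrow> 'v::countable" and x y :: 'v and n :: enat
  assumes "x \<noteq> y"
    and "n = ecard {e. s e = x \<and> r e = y}"
    and "1 \<le> n"
  shows "seq_n_generated r s (Kxy r s x y) (qrad r s (Kxy r s x y)) n
    \<and> is_wgen r s (Kxy r s x y) (qrad r s (Kxy r s x y)) (Lop r s ` {e. s e = x \<and> r e = y})
    \<and> ecard (Lop r s ` {e. s e = x \<and> r e = y}) = n
    \<and> seq_limits r s (Kxy r s x y) (alg_ideal r s (Kxy r s x y) (Lop r s ` {e. s e = x \<and> r e = y}))
        = qrad r s (Kxy r s x y)
    \<and> (\<forall>S. is_wgen r s (Kxy r s x y) (qrad r s (Kxy r s x y)) S \<longrightarrow> n \<le> ecard S)"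
proof -
  let ?K = "Kxy r s x y" and ?R = "rep_nilpotent r s x y" and ?G = "Lop r s ` {e. s e = x \<and> r e = y}"
  have "Lop r s e \<in> ?R" if "s e = x" "r e = y" for e
    using Lop_rep_nilpotent[of s e r] assms(1) that by simp
  then have GR: "?G \<subseteq> ?R" by blast
  have lim: "seq_limits r s ?K (alg_ideal r s ?K ?G) = ?R"
    using rep_nilpotent_subset_seq_limits[OF assms(1)]
      seq_limits_subset[OF q_closed_rep_nilpotent alg_ideal_subset[OF q_ideal_rep_nilpotent GR]]
    by blast
  have "wgen_ideal r s ?K ?G = ?R"
  proof
    show "wgen_ideal r s ?K ?G \<subseteq> ?R"
      unfolding wgen_ideal_def
      by (rule Inter_lower) (simp add: q_closed_rep_nilpotent q_ideal_rep_nilpotent GR)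
    \<comment> \<open>A weak-* closed ideal contains all sequential limits of its elements, so
      sequential generation already implies weak-* generation.\<close>
    have "?R \<subseteq> J" if "q_ideal r s ?K J" "q_closed r s ?K J" "?G \<subseteq> J" for J
      using seq_limits_subset[OF that(2) alg_ideal_subset[OF that(1,3)]] lim by simp
    then show "?R \<subseteq> wgen_ideal r s ?K ?G" unfolding wgen_ideal_def by (intro Inter_greatest) simp
  qed
  then have gen: "is_wgen r s ?K ?R ?G"
    by (auto simp: is_wgen_def Lop_LG)
  have card: "ecard ?G = n"
    using assms(2) inj_on_subset[OF inj_Lop subset_UNIV, of r s "{e. s e = x \<and> r e = y}"]
    by (simp add: ecard_def card_image finite_image_iff)
  have lower: "n \<le> ecard S" if "is_wgen r s ?K ?R S" for S
    using generators_lower_bound[OF assms(1) that] assms(2) by simp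
  show ?thesis
    unfolding qrad_Kxy seq_n_generated_def n_generated_def using gen card lim lower by blast
qed

end
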